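(* Let $H=H_0+V$ where $V$ is $(\Gamma,\mathcal M)$ pseudo-ergodic, and let $K=H_0+W$ where $W:X\to\mathcal M$ is arbitrary. Then $\mathrm{Spec}(K)\subseteq \mathrm{Spec}(H)$. In particular, if $V$ and $W$ are both $(\Gamma,\mathcal M)$ pseudo-ergodic then $\mathrm{Spec}(H)=\mathrm{Spec}(K)$.
   Context: $X$ is a countable set on which a group $\Gamma$ acts by permutations, $\mathcal K$ is a complex Hilbert space, and operators act on $l^2(X,\mathcal K)\cong l^2(X)\otimes\mathcal K$. For $\gamma\in\Gamma$ the unitary $U_\gamma$ is $(U_\gamma f)(x)=f(\gamma^{-1}x)$. $H_0$ is a bounded operator on $l^2(X)$ with $H_0U_\gamma=U_\gamma H_0$ for all $\gamma\in\Gamma$; the operator $H_0\otimes I$ on $l^2(X,\mathcal K)$ is also written $H_0$. $\mathcal M\subseteq\mathcal L(\mathcal K)$ (bounded operators on $\mathcal K$) is a norm closed, bounded set. A function $V:X\to\mathcal M$ (a potential) is identified with the bounded operator $(Vf)(x)=V(x)f(x)$. A potential $V:X\to\mathcal M$ is $(\Gamma,\mathcal M)$ pseudo-ergodic if for every $\varepsilon>0$, every finite $F\subset X$ and every $W:F\to\mathcal M$ there exists $\gamma\in\Gamma$ such that $\|W(x)-V(\gamma x)\|<\varepsilon$ for all $x\in F$. *)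

theory Defs
  imports "HOL-Analysis.Analysis" "HOL-Algebra.Group_Action"
begin

class complex_inner = real_normed_vector +
  fixes scaleC :: "complex \<Rightarrow> 'a \<Rightarrow> 'a" (infixr "*\<^sub>C" 75)
    and cinner :: "'a \<Rightarrow> 'a \<Rightarrow> complex"
  assumes scaleC_add_right: "a *\<^sub>C (x + y) = a *\<^sub>C x + a *\<^sub>C y"
    and scaleC_add_left: "(a + b) *\<^sub>C x = a *\<^sub>C x + b *\<^sub>C x"
    and scaleC_scaleC: "a *\<^sub>C (b *\<^sub>C x) = (a * b) *\<^sub>C x"
    and scaleC_of_real: "complex_of_real r *\<^sub>C x = r *\<^sub>R x"
    and cinner_commute: "cinner x y = cnj (cinner y x)"
    and cinner_add_left: "cinner (x + y) z = cinner x z + cinner y z"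
    and cinner_scaleC_left: "cinner (a *\<^sub>C x) y = a * cinner x y"
    and cinner_self: "cinner x x = complex_of_real ((norm x)\<^sup>2)"

class complex_hilbert = complex_inner + complete_space

instance complex_hilbert \<subseteq> banach ..

lemma scaleC_one [simp]: "1 *\<^sub>C x = (x::'a::complex_inner)"
  using scaleC_of_real[of 1 x] by simp

lemma scaleC_zero_left [simp]: "0 *\<^sub>C x = (0::'a::complex_inner)"
  using scaleC_of_real[of 0 x] by simp

lemma scaleC_zero_right [simp]: "a *\<^sub>C 0 = (0::'a::complex_inner)"
  using scaleC_add_right[of a 0 "0::'a"] by simp

lemma scaleC_minus_right: "a *\<^sub>C (- x) = - (a *\<^sub>C (x::'a::complex_inner))"
  using scaleC_add_right[of a x "-x"] by (simp add: eq_neg_iff_add_eq_0 add.commute)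

lemma scaleC_diff_right: "a *\<^sub>C (x - y) = a *\<^sub>C x - a *\<^sub>C (y::'a::complex_inner)"
  using scaleC_add_right[of a x "-y"] by (simp add: scaleC_minus_right)

lemma scaleC_scaleR: "a *\<^sub>C (r *\<^sub>R x) = r *\<^sub>R (a *\<^sub>C (x::'a::complex_inner))"
  by (simp add: scaleC_of_real[symmetric] scaleC_scaleC mult.commute)

lemma scaleC_sum_right: "a *\<^sub>C (\<Sum>i\<in>A. f i) = (\<Sum>i\<in>A. a *\<^sub>C (f i :: 'a::complex_inner))"
  by (induction A rule: infinite_finite_induct) (auto simp: scaleC_add_right)

lemma scaleC_sum_left: "(\<Sum>i\<in>A. g i) *\<^sub>C x = (\<Sum>i\<in>A. g i *\<^sub>C (x :: 'a::complex_inner))"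
  by (induction A rule: infinite_finite_induct) (auto simp: scaleC_add_left)

lemma cinner_add_right: "cinner x (y + z) = cinner x y + cinner x (z::'a::complex_inner)"
  by (metis cinner_commute cinner_add_left complex_cnj_add)

lemma cinner_scaleC_right: "cinner x (a *\<^sub>C y) = cnj a * cinner x (y::'a::complex_inner)"
  by (metis cinner_commute cinner_scaleC_left complex_cnj_mult)

lemma cinner_zero_left [simp]: "cinner 0 x = 0" for x :: "'a::complex_inner"
  using cinner_scaleC_left[of 0 0 x] by simp

lemma cinner_zero_right [simp]: "cinner x 0 = 0" for x :: "'a::complex_inner"
  using cinner_scaleC_right[of x 0 0] by simp

lemma cinner_sum_left: "cinner (\<Sum>i\<in>A. f i) x = (\<Sum>i\<in>A. cinner (f i) (x::'a::complex_inner))"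
  by (induction A rule: infinite_finite_induct) (auto simp: cinner_add_left)

lemma cinner_sum_right: "cinner x (\<Sum>i\<in>A. f i) = (\<Sum>i\<in>A. cinner (x::'a::complex_inner) (f i))"
  by (induction A rule: infinite_finite_induct) (auto simp: cinner_add_right)

lemma norm_scaleC [simp]: "norm (a *\<^sub>C x) = cmod a * norm (x::'a::complex_inner)"
proof -
  have "complex_of_real ((norm (a *\<^sub>C x))\<^sup>2) = (a * cnj a) * complex_of_real ((norm x)\<^sup>2)"
    by (simp only: cinner_self[symmetric] cinner_scaleC_left cinner_scaleC_right mult_ac)
  also have "\<dots> = complex_of_real ((cmod a * norm x)\<^sup>2)"
    by (simp add: complex_norm_square[symmetric] power_mult_distrib flip: of_real_power)
  finally have "(norm (a *\<^sub>C x))\<^sup>2 = (cmod a * norm x)\<^sup>2"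
    by (simp only: of_real_eq_iff)
  then show ?thesis
    by (simp add: power2_eq_iff_nonneg)
qed

lemma abs_Re_cinner_le: "\<bar>Re (cinner x y)\<bar> \<le> norm x * norm (y::'a::complex_inner)"
proof -
  have norm2: "(norm (u + v))\<^sup>2 = (norm u)\<^sup>2 + (norm v)\<^sup>2 + 2 * Re (cinner u v)" for u v :: 'a
  proof -
    have "cinner (u + v) (u + v) = cinner u u + cinner v v + (cinner u v + cnj (cinner u v))"
      by (metis (no_types, lifting) add.assoc add.commute cinner_add_left cinner_add_right cinner_commute)
    then have "Re (cinner (u + v) (u + v)) = Re (cinner u u) + Re (cinner v v) + 2 * Re (cinner u v)"
      by simp
    then show ?thesis by (simp add: cinner_self)
  qed
  have *: "Re (cinner u v) \<le> norm u * norm v" for u v :: 'a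
  proof -
    have "(norm (u + v))\<^sup>2 \<le> (norm u + norm v)\<^sup>2"
      by (intro power_mono norm_triangle_ineq) auto
    then show ?thesis using norm2[of u v] by (simp add: power2_sum)
  qed
  have "cinner ((-1) *\<^sub>C x) y = - cinner x y" by (simp add: cinner_scaleC_left)
  then have "- Re (cinner x y) \<le> norm x * norm y"
    using *[of "(-1) *\<^sub>C x" y] by simp
  with *[of x y] show ?thesis by linarith
qed

lemma cinner_cauchy_schwarz: "cmod (cinner x y) \<le> norm x * norm (y::'a::complex_inner)"
proof (cases "cinner x y = 0")
  case False
  define a where "a = cnj (sgn (cinner x y))"
  have a: "cmod a = 1" using False by (simp add: a_def norm_sgn)
  have "a * cinner x y = complex_of_real (cmod (cinner x y))"
    using False by (simp add: a_def sgn_eq complex_norm_square[symmetric] power2_eq_square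
        mult.commute[of "cnj _"])
  then have "cmod (cinner x y) = Re (cinner (a *\<^sub>C x) y)"
    by (simp add: cinner_scaleC_left)
  also have "\<dots> \<le> norm (a *\<^sub>C x) * norm y"
    using abs_Re_cinner_le[of "a *\<^sub>C x" y] by linarith
  finally show ?thesis by (simp add: a)
qed simp

instantiation complex :: complex_hilbert
begin

definition scaleC_complex :: "complex \<Rightarrow> complex \<Rightarrow> complex" where
  "scaleC_complex a z = a * z"

definition cinner_complex :: "complex \<Rightarrow> complex \<Rightarrow> complex" where
  "cinner_complex z w = z * cnj w"

instance
proof
  fix x :: complex
  show "cinner x x = complex_of_real ((norm x)\<^sup>2)"
    by (simp only: cinner_complex_def complex_norm_square)
qed (auto simp: scaleC_complex_def cinner_complex_def algebra_simps scaleR_conv_of_real)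

end

definition square_summable :: "('x \<Rightarrow> 'k::real_normed_vector) \<Rightarrow> bool" where
  "square_summable f \<longleftrightarrow> (\<lambda>x. (norm (f x))\<^sup>2) summable_on UNIV"

typedef (overloaded) ('x, 'k::complex_inner) ell2 = "{f :: 'x \<Rightarrow> 'k. square_summable f}"
  morphisms ell2_apply Abs_ell2
  by (rule exI[of _ "\<lambda>_. 0"]) (simp add: square_summable_def)

setup_lifting type_definition_ell2

lemma square_summable_ell2_apply [simp]: "square_summable (ell2_apply f)"
  using ell2_apply[of f] by simp

lemma L2_set_sq: "(L2_set f A)\<^sup>2 = (\<Sum>x\<in>A. (f x)\<^sup>2)"
  by (simp add: L2_set_def sum_nonneg)

lemma square_summableI:
  fixes f :: "'x \<Rightarrow> 'k::real_normed_vector"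
  assumes "\<And>F. finite F \<Longrightarrow> L2_set (\<lambda>x. norm (f x)) F \<le> C"
  shows "square_summable f"
  unfolding square_summable_def
proof (rule nonneg_bdd_above_summable_on)
  show "bdd_above (sum (\<lambda>x. (norm (f x))\<^sup>2) ` {F. F \<subseteq> UNIV \<and> finite F})"
  proof (rule bdd_aboveI2)
    fix F :: "'x set" assume "F \<in> {F. F \<subseteq> UNIV \<and> finite F}"
    then have "(L2_set (\<lambda>x. norm (f x)) F)\<^sup>2 \<le> C\<^sup>2"
      by (intro power_mono assms) auto
    then show "(\<Sum>x\<in>F. (norm (f x))\<^sup>2) \<le> C\<^sup>2" by (simp add: L2_set_sq)
  qed
qed auto

definition ell2_norm :: "('x \<Rightarrow> 'k::real_normed_vector) \<Rightarrow> real" where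
  "ell2_norm f = sqrt (\<Sum>\<^sub>\<infinity>x. (norm (f x))\<^sup>2)"

lemma ell2_norm_nonneg: "0 \<le> ell2_norm f"
  by (simp add: ell2_norm_def infsum_nonneg)

lemma L2_set_le_ell2_norm:
  assumes "square_summable f" "finite F"
  shows "L2_set (\<lambda>x. norm (f x)) F \<le> ell2_norm f"
  unfolding L2_set_def ell2_norm_def
  using assms by (intro real_sqrt_le_mono finite_sum_le_infsum) (auto simp: square_summable_def)

lemma ell2_norm_leI:
  fixes f :: "'x \<Rightarrow> 'k::real_normed_vector"
  assumes "square_summable f" and "\<And>F. finite F \<Longrightarrow> L2_set (\<lambda>x. norm (f x)) F \<le> C"
  shows "ell2_norm f \<le> C"
proof -
  have C: "0 \<le> C" using assms(2)[of "{}"] by simp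
  have "(\<Sum>\<^sub>\<infinity>x. (norm (f x))\<^sup>2) \<le> C\<^sup>2"
  proof (rule infsum_le_finite_sums)
    fix F :: "'x set" assume "finite F"
    then have "(L2_set (\<lambda>x. norm (f x)) F)\<^sup>2 \<le> C\<^sup>2"
      by (intro power_mono assms) auto
    then show "(\<Sum>x\<in>F. (norm (f x))\<^sup>2) \<le> C\<^sup>2" by (simp add: L2_set_sq)
  qed (use assms(1) in \<open>auto simp: square_summable_def\<close>)
  then have "ell2_norm f \<le> sqrt (C\<^sup>2)"
    unfolding ell2_norm_def by (rule real_sqrt_le_mono)
  with C show ?thesis by simp
qed

lemma L2_norm_add_le:
  fixes f g :: "'x \<Rightarrow> 'k::real_normed_vector"
  assumes "square_summable f" "square_summable g" "finite F"
  shows "L2_set (\<lambda>x. norm (f x + g x)) F \<le> ell2_norm f + ell2_norm g"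
proof -
  have "L2_set (\<lambda>x. norm (f x + g x)) F \<le> L2_set (\<lambda>x. norm (f x) + norm (g x)) F"
    by (intro L2_set_mono norm_triangle_ineq) auto
  also have "\<dots> \<le> L2_set (\<lambda>x. norm (f x)) F + L2_set (\<lambda>x. norm (g x)) F"
    by (rule L2_set_triangle_ineq)
  also have "\<dots> \<le> ell2_norm f + ell2_norm g"
    by (intro add_mono L2_set_le_ell2_norm assms)
  finally show ?thesis .
qed

lemma L2_norm_mult_le:
  assumes "square_summable f" "finite F" "\<And>x. norm (g x) \<le> C * norm (f x)" "0 \<le> C"
  shows "L2_set (\<lambda>x. norm (g x)) F \<le> C * ell2_norm f"
proof -
  have "L2_set (\<lambda>x. norm (g x)) F \<le> L2_set (\<lambda>x. C * norm (f x)) F"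
    by (intro L2_set_mono assms(3)) auto
  also have "\<dots> = C * L2_set (\<lambda>x. norm (f x)) F"
    using assms(4) by (simp add: L2_set_right_distrib)
  also have "\<dots> \<le> C * ell2_norm f"
    by (intro mult_left_mono L2_set_le_ell2_norm assms)
  finally show ?thesis .
qed

lemma square_summable_zero [simp]: "square_summable (\<lambda>x. 0)"
  by (simp add: square_summable_def)

lemma square_summable_add [intro]:
  "square_summable f \<Longrightarrow> square_summable g \<Longrightarrow> square_summable (\<lambda>x. f x + g x)"
  by (rule square_summableI, rule L2_norm_add_le) auto

lemma square_summable_le:
  assumes "square_summable f" "\<And>x. norm (g x) \<le> C * norm (f x)" "0 \<le> C"
  shows "square_summable g"
  by (rule square_summableI[of _ "C * ell2_norm f"]) (intro L2_norm_mult_le assms)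

lemma ell2_norm_le:
  assumes "square_summable f" "\<And>x. norm (g x) \<le> C * norm (f x)" "0 \<le> C"
  shows "ell2_norm g \<le> C * ell2_norm f"
  by (intro ell2_norm_leI square_summable_le[OF assms] L2_norm_mult_le assms)

lemma square_summable_uminus [intro]: "square_summable f \<Longrightarrow> square_summable (\<lambda>x. - f x)"
  by (rule square_summable_le[where C=1]) auto

lemma square_summable_diff [intro]:
  "square_summable f \<Longrightarrow> square_summable g \<Longrightarrow> square_summable (\<lambda>x. f x - g x)"
  using square_summable_add[of f "\<lambda>x. - g x"] square_summable_uminus[of g] by simp

lemma square_summable_scaleR [intro]: "square_summable f \<Longrightarrow> square_summable (\<lambda>x. r *\<^sub>R f x)"
  by (rule square_summable_le[where C="\<bar>r\<bar>"]) auto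

lemma square_summable_scaleC [intro]:
  "square_summable f \<Longrightarrow> square_summable (\<lambda>x. a *\<^sub>C (f x :: 'k::complex_inner))"
  by (rule square_summable_le[where C="cmod a"]) auto

lemma abs_summable_cinner:
  fixes f g :: "'x \<Rightarrow> 'k::complex_inner"
  assumes "square_summable f" "square_summable g"
  shows "(\<lambda>x. cinner (f x) (g x)) summable_on UNIV"
proof -
  have s: "(\<lambda>x. (norm (f x))\<^sup>2 + (norm (g x))\<^sup>2) summable_on UNIV"
    using assms unfolding square_summable_def by (rule summable_on_add)
  have b: "cmod (cinner (f x) (g x)) \<le> (norm (f x))\<^sup>2 + (norm (g x))\<^sup>2" for x
  proof -
    have "0 \<le> (norm (f x) - norm (g x))\<^sup>2" by simp
    then have "2 * (norm (f x) * norm (g x)) \<le> (norm (f x))\<^sup>2 + (norm (g x))\<^sup>2"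
      by (simp add: power2_diff)
    moreover have "0 \<le> norm (f x) * norm (g x)" by simp
    ultimately show ?thesis using cinner_cauchy_schwarz[of "f x" "g x"] by linarith
  qed
  have "(\<lambda>x. cmod (cinner (f x) (g x))) summable_on UNIV"
    by (rule summable_on_comparison_test[OF s]) (use b in auto)
  then show ?thesis by (rule abs_summable_summable)
qed

instantiation ell2 :: (type, complex_inner) complex_inner
begin

lift_definition zero_ell2 :: "('a, 'b) ell2" is "\<lambda>x. 0" by simp
lift_definition plus_ell2 :: "('a, 'b) ell2 \<Rightarrow> ('a, 'b) ell2 \<Rightarrow> ('a, 'b) ell2"
  is "\<lambda>f g x. f x + g x" by auto
lift_definition minus_ell2 :: "('a, 'b) ell2 \<Rightarrow> ('a, 'b) ell2 \<Rightarrow> ('a, 'b) ell2"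
  is "\<lambda>f g x. f x - g x" by auto
lift_definition uminus_ell2 :: "('a, 'b) ell2 \<Rightarrow> ('a, 'b) ell2"
  is "\<lambda>f x. - f x" by auto
lift_definition scaleR_ell2 :: "real \<Rightarrow> ('a, 'b) ell2 \<Rightarrow> ('a, 'b) ell2"
  is "\<lambda>r f x. r *\<^sub>R f x" by auto
lift_definition scaleC_ell2 :: "complex \<Rightarrow> ('a, 'b) ell2 \<Rightarrow> ('a, 'b) ell2"
  is "\<lambda>a f x. a *\<^sub>C f x" by auto
lift_definition cinner_ell2 :: "('a, 'b) ell2 \<Rightarrow> ('a, 'b) ell2 \<Rightarrow> complex"
  is "\<lambda>f g. \<Sum>\<^sub>\<infinity>x. cinner (f x) (g x)" .
lift_definition norm_ell2 :: "('a, 'b) ell2 \<Rightarrow> real" is ell2_norm .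

definition sgn_ell2 :: "('a, 'b) ell2 \<Rightarrow> ('a, 'b) ell2" where
  "sgn_ell2 f = inverse (norm f) *\<^sub>R f"
definition dist_ell2 :: "('a, 'b) ell2 \<Rightarrow> ('a, 'b) ell2 \<Rightarrow> real" where
  "dist_ell2 f g = norm (f - g)"
definition uniformity_ell2 :: "(('a, 'b) ell2 \<times> ('a, 'b) ell2) filter" where
  "uniformity_ell2 = (INF e\<in>{0<..}. principal {(f, g). dist f g < e})"
definition open_ell2 :: "('a, 'b) ell2 set \<Rightarrow> bool" where
  "open_ell2 U = (\<forall>f\<in>U. \<forall>\<^sub>F (f', g) in uniformity. f' = f \<longrightarrow> g \<in> U)"

instance
proof
  fix f g h :: "('a, 'b) ell2" and r s :: real and a b :: complex
  show "f + g + h = f + (g + h)" by transfer (auto simp: algebra_simps)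
  show "f + g = g + f" by transfer (auto simp: algebra_simps)
  show "0 + f = f" by transfer auto
  show "- f + f = 0" by transfer auto
  show "f - g = f + - g" by transfer auto
  show "r *\<^sub>R (f + g) = r *\<^sub>R f + r *\<^sub>R g" by transfer (auto simp: algebra_simps)
  show "(r + s) *\<^sub>R f = r *\<^sub>R f + s *\<^sub>R f" by transfer (auto simp: algebra_simps)
  show "r *\<^sub>R s *\<^sub>R f = (r * s) *\<^sub>R f" by transfer auto
  show "1 *\<^sub>R f = f" by transfer auto
  show "dist f g = norm (f - g)" by (rule dist_ell2_def)
  show "sgn f = inverse (norm f) *\<^sub>R f" by (rule sgn_ell2_def)
  show "uniformity = (INF e\<in>{0<..}. principal {(f, g::('a, 'b) ell2). dist f g < e})"
    by (rule uniformity_ell2_def)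
  show "open U = (\<forall>f\<in>U. \<forall>\<^sub>F (f', g) in uniformity. f' = f \<longrightarrow> g \<in> U)" for U :: "('a, 'b) ell2 set"
    by (rule open_ell2_def)
  show "(norm f = 0) = (f = 0)"
  proof transfer
    fix f :: "'a \<Rightarrow> 'b" assume f: "square_summable f"
    show "(ell2_norm f = 0) = (f = (\<lambda>x. 0))"
    proof
      assume "ell2_norm f = 0"
      then have "norm (f x) \<le> 0" for x
        using L2_set_le_ell2_norm[OF f, of "{x}"] by simp
      then show "f = (\<lambda>x. 0)" by auto
    qed (simp add: ell2_norm_def)
  qed
  show "norm (f + g) \<le> norm f + norm g"
    by transfer (intro ell2_norm_leI L2_norm_add_le square_summable_add)
  show "norm (r *\<^sub>R f) = \<bar>r\<bar> * norm f"
    by transfer (simp add: ell2_norm_def power_mult_distrib infsum_cmult_right' real_sqrt_mult)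
  show "a *\<^sub>C (f + g) = a *\<^sub>C f + a *\<^sub>C g" by transfer (auto simp: scaleC_add_right)
  show "(a + b) *\<^sub>C f = a *\<^sub>C f + b *\<^sub>C f" by transfer (auto simp: scaleC_add_left)
  show "a *\<^sub>C (b *\<^sub>C f) = (a * b) *\<^sub>C f" by transfer (auto simp: scaleC_scaleC)
  show "complex_of_real r *\<^sub>C f = r *\<^sub>R f" by transfer (auto simp: scaleC_of_real)
  show "cinner f g = cnj (cinner g f)"
    by transfer (simp add: infsum_cnj[symmetric] cinner_commute[symmetric] del: infsum_cnj)
  show "cinner (f + g) h = cinner f h + cinner g h"
    by transfer (simp add: cinner_add_left infsum_add abs_summable_cinner)
  show "cinner (a *\<^sub>C f) g = a * cinner f g"
    by transfer (simp add: cinner_scaleC_left infsum_cmult_right')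
  show "cinner f f = complex_of_real ((norm f)\<^sup>2)"
  proof transfer
    fix f :: "'a \<Rightarrow> 'b" assume f: "square_summable f"
    have "((\<lambda>x. (norm (f x))\<^sup>2) has_sum (\<Sum>\<^sub>\<infinity>x. (norm (f x))\<^sup>2)) UNIV"
      using f by (simp add: square_summable_def)
    then have "((\<lambda>x. complex_of_real ((norm (f x))\<^sup>2)) has_sum
        complex_of_real (\<Sum>\<^sub>\<infinity>x. (norm (f x))\<^sup>2)) UNIV"
      by (rule has_sum_of_real)
    moreover have "(ell2_norm f)\<^sup>2 = (\<Sum>\<^sub>\<infinity>x. (norm (f x))\<^sup>2)"
      by (simp add: ell2_norm_def infsum_nonneg)
    ultimately show "(\<Sum>\<^sub>\<infinity>x. cinner (f x) (f x)) = complex_of_real ((ell2_norm f)\<^sup>2)"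
      by (simp only: cinner_self infsumI)
  qed
qed

end

lemma ell2_apply_simps [simp]:
  "ell2_apply 0 x = 0"
  "ell2_apply (f + g) x = ell2_apply f x + ell2_apply g x"
  "ell2_apply (f - g) x = ell2_apply f x - ell2_apply g x"
  "ell2_apply (- f) x = - ell2_apply f x"
  "ell2_apply (r *\<^sub>R f) x = r *\<^sub>R ell2_apply f x"
  "ell2_apply (a *\<^sub>C f) x = a *\<^sub>C ell2_apply f x"
  by (transfer; simp)+

lemma ell2_apply_sum [simp]: "ell2_apply (\<Sum>i\<in>A. f i) x = (\<Sum>i\<in>A. ell2_apply (f i) x)"
  by (induction A rule: infinite_finite_induct) auto

lemma ell2_eqI: "(\<And>x. ell2_apply f x = ell2_apply g x) \<Longrightarrow> f = g"
  by transfer auto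

lemma ell2_apply_Abs: "square_summable f \<Longrightarrow> ell2_apply (Abs_ell2 f) = f"
  by (simp add: Abs_ell2_inverse)

lemma L2_set_le_norm: "finite F \<Longrightarrow> L2_set (\<lambda>x. norm (ell2_apply f x)) F \<le> norm f"
  by transfer (rule L2_set_le_ell2_norm)

lemma norm_ell2_apply_le: "norm (ell2_apply f x) \<le> norm f"
  using L2_set_le_norm[of "{x}" f] by simp

lemma norm_ell2_leI:
  "(\<And>F. finite F \<Longrightarrow> L2_set (\<lambda>x. norm (ell2_apply f x)) F \<le> C) \<Longrightarrow> norm f \<le> C"
  by transfer (rule ell2_norm_leI)

instance ell2 :: (type, complex_hilbert) complex_hilbert
proof
  fix X :: "nat \<Rightarrow> ('a, 'b) ell2"
  assume X: "Cauchy X"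
  have "Cauchy (\<lambda>n. ell2_apply (X n) x)" for x
  proof (rule metric_CauchyI)
    fix e :: real assume "0 < e"
    then obtain N where N: "\<And>m n. m \<ge> N \<Longrightarrow> n \<ge> N \<Longrightarrow> dist (X m) (X n) < e"
      using X by (metis metric_CauchyD)
    have "dist (ell2_apply (X m) x) (ell2_apply (X n) x) \<le> dist (X m) (X n)" for m n
      using norm_ell2_apply_le[of "X m - X n" x] by (simp add: dist_norm)
    with N show "\<exists>N. \<forall>m\<ge>N. \<forall>n\<ge>N. dist (ell2_apply (X m) x) (ell2_apply (X n) x) < e"
      by (meson le_less_trans)
  qed
  then have "\<exists>l. (\<lambda>n. ell2_apply (X n) x) \<longlonglongrightarrow> l" for x
    using Cauchy_convergent convergent_def by blast
  then obtain g where g: "\<And>x. (\<lambda>n. ell2_apply (X n) x) \<longlonglongrightarrow> g x" by metis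
  have key: "\<exists>N. \<forall>m\<ge>N. \<forall>F. finite F \<longrightarrow> L2_set (\<lambda>x. norm (ell2_apply (X m) x - g x)) F \<le> e"
    if e: "0 < e" for e :: real
  proof -
    obtain N where N: "\<And>m n. m \<ge> N \<Longrightarrow> n \<ge> N \<Longrightarrow> dist (X m) (X n) < e"
      using X e by (metis metric_CauchyD)
    have "L2_set (\<lambda>x. norm (ell2_apply (X m) x - g x)) F \<le> e" if m: "m \<ge> N" and F: "finite F" for m F
    proof (rule tendsto_upperbound)
      show "(\<lambda>n. L2_set (\<lambda>x. norm (ell2_apply (X m) x - ell2_apply (X n) x)) F)
          \<longlonglongrightarrow> L2_set (\<lambda>x. norm (ell2_apply (X m) x - g x)) F"
        unfolding L2_set_def by (intro tendsto_intros g)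
      have "L2_set (\<lambda>x. norm (ell2_apply (X m) x - ell2_apply (X n) x)) F \<le> e" if "n \<ge> N" for n
        using L2_set_le_norm[OF F, of "X m - X n"] N[OF m that] by (simp add: dist_norm)
      then show "\<forall>\<^sub>F n in sequentially.
          L2_set (\<lambda>x. norm (ell2_apply (X m) x - ell2_apply (X n) x)) F \<le> e"
        using eventually_sequentially by blast
    qed simp
    then show ?thesis by blast
  qed
  obtain N where N: "\<And>F. finite F \<Longrightarrow> L2_set (\<lambda>x. norm (ell2_apply (X N) x - g x)) F \<le> 1"
    using key[of 1] by auto
  have "square_summable (\<lambda>x. ell2_apply (X N) x - g x)"
    using N by (rule square_summableI)
  then have "square_summable (\<lambda>x. ell2_apply (X N) x - (ell2_apply (X N) x - g x))"
    by (rule square_summable_diff[OF square_summable_ell2_apply])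
  then have g2: "square_summable g" by simp
  have "X \<longlonglongrightarrow> Abs_ell2 g"
  proof (rule metric_LIMSEQ_I)
    fix e :: real assume e: "0 < e"
    then obtain N where N: "\<And>m F. m \<ge> N \<Longrightarrow> finite F \<Longrightarrow>
        L2_set (\<lambda>x. norm (ell2_apply (X m) x - g x)) F \<le> e / 2"
      using key[of "e / 2"] by auto
    have "dist (X m) (Abs_ell2 g) \<le> e / 2" if "m \<ge> N" for m
      unfolding dist_norm using N[OF that]
      by (intro norm_ell2_leI) (simp add: ell2_apply_Abs[OF g2])
    with e show "\<exists>N. \<forall>m\<ge>N. dist (X m) (Abs_ell2 g) < e"
      by (intro exI[of _ N]) force
  qed
  then show "convergent X" by (auto simp: convergent_def)
qed

text \<open>The type \<open>'h \<Rightarrow>\<^sub>L 'h\<close> consists of the bounded real-linear operators; the bounded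
  operators of the complex theory are its complex-linear members. The operator norm and the
  norm topology are the ones inherited from \<open>'h \<Rightarrow>\<^sub>L 'h\<close>.\<close>

definition bounded_operators :: "('h::complex_inner \<Rightarrow>\<^sub>L 'h) set" where
  "bounded_operators = {T. \<forall>a x. blinfun_apply T (a *\<^sub>C x) = a *\<^sub>C blinfun_apply T x}"

definition Spec :: "('h::complex_inner \<Rightarrow>\<^sub>L 'h) \<Rightarrow> complex set" where
  "Spec T = {z. \<not> (\<exists>S\<in>bounded_operators. \<forall>f.
      blinfun_apply S (blinfun_apply T f - z *\<^sub>C f) = f \<and>
      blinfun_apply T (blinfun_apply S f) - z *\<^sub>C blinfun_apply S f = f)}"

text \<open>Here \<open>\<phi> \<gamma> x\<close> is \<open>\<gamma>x\<close>. \<open>Blinfun\<close> and \<open>Abs_ell2\<close> are meaningful only on bounded linear maps and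
  on square-summable functions; \<open>translation_apply\<close> and \<open>potential_op_apply\<close> below show that
  this is the case for group actions and for bounded potentials.\<close>

definition translation ::
  "('g, 'm) monoid_scheme \<Rightarrow> ('g \<Rightarrow> 'x \<Rightarrow> 'x) \<Rightarrow> 'g \<Rightarrow> ('x, 'k::complex_inner) ell2 \<Rightarrow>\<^sub>L ('x, 'k) ell2"
  where "translation G \<phi> \<gamma> =
    Blinfun (\<lambda>f. Abs_ell2 (\<lambda>x. ell2_apply f (\<phi> (inv\<^bsub>G\<^esub> \<gamma>) x)))"

definition potential_op ::
  "('x \<Rightarrow> 'k \<Rightarrow>\<^sub>L 'k) \<Rightarrow> ('x, 'k::complex_inner) ell2 \<Rightarrow>\<^sub>L ('x, 'k) ell2"
  where "potential_op V =
    Blinfun (\<lambda>f. Abs_ell2 (\<lambda>x. blinfun_apply (V x) (ell2_apply f x)))"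

text \<open>\<open>W\<close> is a total function, but only its values on \<open>F\<close> are constrained or used, so it ranges
  over all \<open>F \<rightarrow> M\<close>.\<close>

definition pseudo_ergodic ::
  "('g, 'm) monoid_scheme \<Rightarrow> ('g \<Rightarrow> 'x \<Rightarrow> 'x) \<Rightarrow> ('k \<Rightarrow>\<^sub>L 'k) set
    \<Rightarrow> ('x \<Rightarrow> 'k::complex_inner \<Rightarrow>\<^sub>L 'k) \<Rightarrow> bool"
  where "pseudo_ergodic G \<phi> M V \<longleftrightarrow>
    (\<forall>x. V x \<in> M) \<and>
    (\<forall>\<epsilon>>0. \<forall>F W. finite F \<and> (\<forall>x\<in>F. W x \<in> M) \<longrightarrow>
      (\<exists>\<gamma>\<in>carrier G. \<forall>x\<in>F. norm (W x - V (\<phi> \<gamma> x)) < \<epsilon>))"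

lemma translation_apply:
  fixes f :: "('x, 'k::complex_inner) ell2"
  assumes "group_action G UNIV \<phi>" "\<gamma> \<in> carrier G"
  shows "ell2_apply (blinfun_apply (translation G \<phi> \<gamma>) f) x = ell2_apply f (\<phi> (inv\<^bsub>G\<^esub> \<gamma>) x)"
proof -
  define p where "p = \<phi> (inv\<^bsub>G\<^esub> \<gamma>)"
  have "group G"
    using assms(1) by (simp add: group_action_def group_hom_def)
  then have "inv\<^bsub>G\<^esub> \<gamma> \<in> carrier G"
    using assms(2) by (rule group.inv_closed)
  then have bij: "bij p"
    using group_action.bij_prop0[OF assms(1)] by (auto simp: Bij_def p_def)
  define L where "L f = Abs_ell2 (\<lambda>x. ell2_apply f (p x))" for f :: "('x, 'k) ell2"
  have "square_summable (\<lambda>x. ell2_apply f (p x))" for f :: "('x, 'k) ell2"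
    using summable_on_reindex_bij_betw[OF bij, of "\<lambda>x. (norm (ell2_apply f x))\<^sup>2"]
      square_summable_ell2_apply[of f] by (simp add: square_summable_def)
  then have L: "ell2_apply (L f) x = ell2_apply f (p x)" for f x
    unfolding L_def by (subst ell2_apply_Abs) auto
  have nn: "norm (L f) = norm f" for f
    using infsum_reindex_bij_betw[OF bij, of "\<lambda>x. (norm (ell2_apply f x))\<^sup>2"]
    by (simp add: norm_ell2.rep_eq L ell2_norm_def)
  have "bounded_linear L"
  proof (rule bounded_linear_intro[where K=1])
    show "L (f + g) = L f + L g" for f g by (rule ell2_eqI) (simp add: L)
    show "L (r *\<^sub>R f) = r *\<^sub>R L f" for r f by (rule ell2_eqI) (simp add: L)
  qed (simp add: nn)
  then have "blinfun_apply (translation G \<phi> \<gamma>) = L"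
    unfolding translation_def L_def p_def by (rule bounded_linear_Blinfun_apply)
  then show ?thesis by (simp add: L p_def)
qed

lemma potential_op_apply:
  assumes "bounded (range V)"
  shows "ell2_apply (blinfun_apply (potential_op V) f) x = blinfun_apply (V x) (ell2_apply f x)"
proof -
  obtain C where C: "\<And>x. norm (V x) \<le> C"
    using assms by (auto simp: bounded_iff)
  have C0: "0 \<le> C" using C[of undefined] norm_ge_zero[of "V undefined"] by linarith
  have le: "norm (blinfun_apply (V x) k) \<le> C * norm k" for x k
    by (meson C mult_right_mono norm_blinfun norm_ge_zero order_trans)
  define L where "L f = Abs_ell2 (\<lambda>x. blinfun_apply (V x) (ell2_apply f x))" for f
  have "square_summable (\<lambda>x. blinfun_apply (V x) (ell2_apply f x))" for f
    by (rule square_summable_le[where f="ell2_apply f" and C=C]) (auto simp: le C0)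
  then have L: "ell2_apply (L f) x = blinfun_apply (V x) (ell2_apply f x)" for f x
    unfolding L_def by (subst ell2_apply_Abs) auto
  have nn: "norm (L f) \<le> norm f * C" for f
    unfolding norm_ell2.rep_eq
    by (subst mult.commute, rule ell2_norm_le) (auto simp: le C0 L)
  have "bounded_linear L"
  proof (rule bounded_linear_intro[where K=C])
    show "L (f + g) = L f + L g" for f g by (rule ell2_eqI) (simp add: L blinfun.add_right)
    show "L (r *\<^sub>R f) = r *\<^sub>R L f" for r f by (rule ell2_eqI) (simp add: L blinfun.scaleR_right)
  qed (rule nn)
  then have "blinfun_apply (potential_op V) = L"
    unfolding potential_op_def L_def by (rule bounded_linear_Blinfun_apply)
  then show ?thesis by (simp add: L)
qed

lift_definition elem_tensor :: "('x, complex) ell2 \<Rightarrow> 'k::complex_inner \<Rightarrow> ('x, 'k) ell2"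
  is "\<lambda>f k x. f x *\<^sub>C k"
proof -
  fix f :: "'x \<Rightarrow> complex" and k :: 'k
  assume "square_summable f"
  then show "square_summable (\<lambda>x. f x *\<^sub>C k)"
    by (rule square_summable_le[where C="norm k"]) (auto simp: mult.commute)
qed

lemma elem_tensor_apply [simp]: "ell2_apply (elem_tensor f k) x = ell2_apply f x *\<^sub>C k"
  by (simp add: elem_tensor.rep_eq)

lemma elem_tensor_add_left: "elem_tensor (f + g) k = elem_tensor f k + elem_tensor g k"
  by (rule ell2_eqI) (simp add: scaleC_add_left)

lemma elem_tensor_add_right: "elem_tensor f (k + l) = elem_tensor f k + elem_tensor f l"
  by (rule ell2_eqI) (simp add: scaleC_add_right)

lemma elem_tensor_scaleC_left: "elem_tensor (a *\<^sub>C f) k = a *\<^sub>C elem_tensor f k"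
  by (rule ell2_eqI) (simp add: scaleC_scaleC scaleC_complex_def)

lemma elem_tensor_scaleC_right: "elem_tensor f (a *\<^sub>C k) = a *\<^sub>C elem_tensor f k"
  by (rule ell2_eqI) (simp add: scaleC_scaleC mult.commute)

lemma elem_tensor_scaleR_left: "elem_tensor (r *\<^sub>R f) k = r *\<^sub>R elem_tensor f k"
  by (simp add: elem_tensor_scaleC_left flip: scaleC_of_real)

lemma elem_tensor_scaleR_right: "elem_tensor f (r *\<^sub>R k) = r *\<^sub>R elem_tensor f k"
  by (simp add: elem_tensor_scaleC_right flip: scaleC_of_real)

lemma elem_tensor_sum_left: "elem_tensor (\<Sum>i\<in>A. f i) k = (\<Sum>i\<in>A. elem_tensor (f i) k)"
  by (rule ell2_eqI) (simp add: scaleC_sum_left)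

lemma elem_tensor_sum_right: "elem_tensor f (\<Sum>i\<in>A. k i) = (\<Sum>i\<in>A. elem_tensor f (k i))"
  by (rule ell2_eqI) (simp add: scaleC_sum_right)

lemma cinner_elem_tensor: "cinner (elem_tensor f k) (elem_tensor g l) = cinner f g * cinner k l"
  unfolding cinner_ell2.rep_eq
  by (simp add: cinner_scaleC_left cinner_scaleC_right cinner_complex_def mult_ac
      flip: infsum_cmult_right')

lemma norm_elem_tensor: "norm (elem_tensor f k) = norm f * norm k"
proof -
  have "complex_of_real ((norm (elem_tensor f k))\<^sup>2) = complex_of_real ((norm f * norm k)\<^sup>2)"
    by (simp only: cinner_self[symmetric] cinner_elem_tensor power_mult_distrib of_real_mult)
  then show ?thesis
    by (simp only: of_real_eq_iff) (simp add: power2_eq_iff_nonneg)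
qed

lemma bounded_linear_elem_tensor_left: "bounded_linear (\<lambda>f. elem_tensor f k)"
  by (rule bounded_linear_intro[where K="norm k"])
    (auto simp: elem_tensor_add_left elem_tensor_scaleR_left norm_elem_tensor)

lemma norm_sum_orthogonal:
  fixes v :: "'i \<Rightarrow> 'h::complex_inner"
  assumes "finite A" "\<And>i j. i \<in> A \<Longrightarrow> j \<in> A \<Longrightarrow> i \<noteq> j \<Longrightarrow> cinner (v i) (v j) = 0"
  shows "(norm (\<Sum>i\<in>A. v i))\<^sup>2 = (\<Sum>i\<in>A. (norm (v i))\<^sup>2)"
proof -
  have "complex_of_real ((norm (\<Sum>i\<in>A. v i))\<^sup>2) = (\<Sum>i\<in>A. \<Sum>j\<in>A. cinner (v i) (v j))"
    unfolding cinner_self[symmetric] by (simp only: cinner_sum_left) (simp only: cinner_sum_right)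
  also have "\<dots> = (\<Sum>i\<in>A. \<Sum>j\<in>A. if j = i then cinner (v i) (v i) else 0)"
    using assms(2) by (intro sum.cong refl) auto
  also have "\<dots> = (\<Sum>i\<in>A. cinner (v i) (v i))"
    using assms(1) by (intro sum.cong refl) simp
  also have "\<dots> = complex_of_real (\<Sum>i\<in>A. (norm (v i))\<^sup>2)"
    by (simp add: cinner_self)
  finally show ?thesis by (simp only: of_real_eq_iff)
qed

lemma finite_orthonormal_expansion:
  fixes k :: "'i \<Rightarrow> 'h::complex_inner"
  assumes "finite F"
  shows "\<exists>(n::nat) e c. (\<forall>i<n. \<forall>j<n. cinner (e i) (e j) = (if i = j then 1 else 0)) \<and>
    (\<forall>y\<in>F. k y = (\<Sum>i<n. c y i *\<^sub>C e i))"
  using assms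
proof (induction F rule: finite_induct)
  case empty
  show ?case by (rule exI[of _ 0]) auto
next
  case (insert y F)
  then obtain n :: nat and e c where
    e: "\<And>i j. i < n \<Longrightarrow> j < n \<Longrightarrow> cinner (e i) (e j) = (if i = j then 1 else 0)" and
    c: "\<And>z. z \<in> F \<Longrightarrow> k z = (\<Sum>i<n. c z i *\<^sub>C e i)"
    by blast
  define s where "s = (\<Sum>i<n. cinner (k y) (e i) *\<^sub>C e i)"
  define r where "r = k y + (-1) *\<^sub>C s"
  have ky: "k y = s + r"
    using scaleC_of_real[of "-1" s] by (simp add: r_def)
  have s: "cinner s (e j) = cinner (k y) (e j)" if "j < n" for j
  proof -
    have "cinner s (e j) = (\<Sum>i<n. cinner (k y) (e i) * (if i = j then 1 else 0))"
      unfolding s_def cinner_sum_left using that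
      by (intro sum.cong refl) (simp add: cinner_scaleC_left e)
    also have "\<dots> = (\<Sum>i<n. if i = j then cinner (k y) (e i) else 0)"
      by (intro sum.cong) auto
    also have "\<dots> = cinner (k y) (e j)" using that by simp
    finally show ?thesis .
  qed
  have r1: "cinner r (e j) = 0" if "j < n" for j
    by (simp add: r_def cinner_add_left cinner_scaleC_left s[OF that])
  then have r2: "cinner (e j) r = 0" if "j < n" for j
    using that by (metis cinner_commute complex_cnj_zero)
  define u where "u = complex_of_real (inverse (norm r)) *\<^sub>C r"
  show ?case
  proof (cases "r = 0")
    case True
    define c' where "c' z = (if z = y then (\<lambda>i. cinner (k y) (e i)) else c z)" for z
    have "\<forall>z\<in>insert y F. k z = (\<Sum>i<n. c' z i *\<^sub>C e i)"
      using c ky True by (auto simp: c'_def s_def)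
    with e show ?thesis by blast
  next
    case False
    have "norm u = 1" using False by (simp add: u_def norm_inverse norm_divide)
    then have u: "cinner u u = 1" by (simp add: cinner_self)
    have ru: "complex_of_real (norm r) *\<^sub>C u = r"
      using False by (simp add: u_def scaleC_scaleC flip: of_real_mult)
    define e' where "e' i = (if i < n then e i else u)" for i
    define c' where "c' z i = (if z = y then (if i < n then cinner (k y) (e i) else complex_of_real (norm r))
      else if i < n then c z i else 0)" for z i
    have "cinner (e' i) (e' j) = (if i = j then 1 else 0)" if "i < Suc n" "j < Suc n" for i j
      using that e u r1 r2
      by (auto simp: e'_def u_def cinner_scaleC_left cinner_scaleC_right less_Suc_eq)
    moreover have "k z = (\<Sum>i<Suc n. c' z i *\<^sub>C e' i)" if "z \<in> insert y F" for z
    proof (cases "z = y")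
      case True
      then show ?thesis using ky ru by (simp add: c'_def e'_def s_def)
    next
      case False
      then show ?thesis using c[of z] that by (simp add: c'_def e'_def)
    qed
    ultimately show ?thesis by blast
  qed
qed

lemma norm_sum_elem_tensor_le:
  fixes h :: "'i \<Rightarrow> ('x, complex) ell2" and k :: "'i \<Rightarrow> 'k::complex_inner"
  assumes F: "finite F"
    and h: "\<And>a. (norm (\<Sum>y\<in>F. a y *\<^sub>C h y))\<^sup>2 \<le> C * (\<Sum>y\<in>F. (cmod (a y))\<^sup>2)"
  shows "(norm (\<Sum>y\<in>F. elem_tensor (h y) (k y)))\<^sup>2 \<le> C * (\<Sum>y\<in>F. (norm (k y))\<^sup>2)"
proof -
  obtain n :: nat and e c where
    e: "\<And>i j. i < n \<Longrightarrow> j < n \<Longrightarrow> cinner (e i) (e j) = (if i = j then 1 else 0)" and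
    c: "\<And>z. z \<in> F \<Longrightarrow> k z = (\<Sum>i<n. c z i *\<^sub>C e i)"
    using finite_orthonormal_expansion[OF F, of k] by blast
  have ne: "norm (e i) = 1" if "i < n" for i
  proof -
    have "complex_of_real ((norm (e i))\<^sup>2) = complex_of_real 1"
      using e[OF that that] by (simp add: cinner_self)
    then have "(norm (e i))\<^sup>2 = 1" by (simp only: of_real_eq_iff)
    then show ?thesis by (simp add: power2_eq_1_iff)
       (metis norm_ge_zero not_one_le_zero neg_0_le_iff_le)
  qed
  have nk: "(norm (k y))\<^sup>2 = (\<Sum>i<n. (cmod (c y i))\<^sup>2)" if "y \<in> F" for y
    unfolding c[OF that]
    by (subst norm_sum_orthogonal) (auto simp: cinner_scaleC_left cinner_scaleC_right e ne)
  have "(\<Sum>y\<in>F. elem_tensor (h y) (k y)) = (\<Sum>y\<in>F. \<Sum>i<n. elem_tensor (c y i *\<^sub>C h y) (e i))"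
    by (intro sum.cong refl)
      (simp add: c elem_tensor_sum_right elem_tensor_scaleC_right elem_tensor_scaleC_left)
  also have "\<dots> = (\<Sum>i<n. elem_tensor (\<Sum>y\<in>F. c y i *\<^sub>C h y) (e i))"
    by (subst sum.swap) (simp add: elem_tensor_sum_left)
  finally have "(norm (\<Sum>y\<in>F. elem_tensor (h y) (k y)))\<^sup>2
      = (norm (\<Sum>i<n. elem_tensor (\<Sum>y\<in>F. c y i *\<^sub>C h y) (e i)))\<^sup>2" by simp
  also have "\<dots> = (\<Sum>i<n. (norm (\<Sum>y\<in>F. c y i *\<^sub>C h y))\<^sup>2)"
    by (subst norm_sum_orthogonal) (auto simp: cinner_elem_tensor e norm_elem_tensor ne)
  also have "\<dots> \<le> (\<Sum>i<n. C * (\<Sum>y\<in>F. (cmod (c y i))\<^sup>2))"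
    by (intro sum_mono h)
  also have "\<dots> = C * (\<Sum>y\<in>F. \<Sum>i<n. (cmod (c y i))\<^sup>2)"
    by (subst sum.swap) (simp add: sum_distrib_left)
  also have "\<dots> = C * (\<Sum>y\<in>F. (norm (k y))\<^sup>2)"
    by (simp add: nk)
  finally show ?thesis .
qed

lift_definition unit_ell2 :: "'x \<Rightarrow> ('x, complex) ell2" is "\<lambda>y x. if x = y then 1 else 0"
proof -
  fix y :: 'x
  have "(\<lambda>x. (norm (if x = y then 1 else 0 :: complex))\<^sup>2) summable_on {y} \<longleftrightarrow>
      (\<lambda>x. (norm (if x = y then 1 else 0 :: complex))\<^sup>2) summable_on UNIV"
    by (rule summable_on_cong_neutral) auto
  then show "square_summable (\<lambda>x. if x = y then 1 else 0 :: complex)"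
    unfolding square_summable_def by simp
qed

lemma unit_ell2_apply [simp]: "ell2_apply (unit_ell2 y) x = (if x = y then 1 else 0)"
  by (simp add: unit_ell2.rep_eq)

lemma cinner_unit: "cinner (elem_tensor (unit_ell2 y) k) f = cinner k (ell2_apply f y)"
proof -
  have "cinner (elem_tensor (unit_ell2 y) k) f = (\<Sum>\<^sub>\<infinity>x. if x = y then cinner k (ell2_apply f y) else 0)"
    unfolding cinner_ell2.rep_eq by (intro infsum_cong) auto
  also have "\<dots> = (\<Sum>\<^sub>\<infinity>x\<in>{y}. cinner k (ell2_apply f y))"
    by (rule infsum_cong_neutral) auto
  finally show ?thesis by simp
qed

lemma norm_sum_unit:
  assumes "finite F"
  shows "(norm (\<Sum>y\<in>F. elem_tensor (unit_ell2 y) (k y)))\<^sup>2 = (\<Sum>y\<in>F. (norm (k y))\<^sup>2)"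
proof -
  have [simp]: "norm (elem_tensor (unit_ell2 y) l) = norm l" for y and l :: 'b
  proof -
    have "complex_of_real ((norm (elem_tensor (unit_ell2 y) l))\<^sup>2) = complex_of_real ((norm l)\<^sup>2)"
      by (simp only: cinner_self[symmetric] cinner_unit) simp
    then show ?thesis
      by (simp only: of_real_eq_iff) (simp add: power2_eq_iff_nonneg)
  qed
  show ?thesis
    using assms by (subst norm_sum_orthogonal) (auto simp: cinner_unit)
qed

lemma has_sum_norm_sq: "((\<lambda>x. (norm (ell2_apply f x))\<^sup>2) has_sum (norm f)\<^sup>2) UNIV"
proof -
  have "(norm f)\<^sup>2 = (\<Sum>\<^sub>\<infinity>x. (norm (ell2_apply f x))\<^sup>2)"
    by (simp add: norm_ell2.rep_eq ell2_norm_def infsum_nonneg)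
  then show ?thesis
    using square_summable_ell2_apply[of f] by (simp add: square_summable_def)
qed

lemma has_sum_unit:
  fixes f :: "('x, 'k::complex_inner) ell2"
  shows "((\<lambda>y. elem_tensor (unit_ell2 y) (ell2_apply f y)) has_sum f) UNIV"
proof -
  define s where "s F = (\<Sum>y\<in>F. elem_tensor (unit_ell2 y) (ell2_apply f y))" for F
  have s_apply: "ell2_apply (s F) x = ell2_apply f x" if "finite F" "x \<in> F" for F x
  proof -
    have "ell2_apply (s F) x = (\<Sum>y\<in>F. if x = y then ell2_apply f y else 0)"
      unfolding s_def ell2_apply_sum by (intro sum.cong refl) simp
    then show ?thesis using that by simp
  qed
  have nrm: "(norm (s F - f))\<^sup>2 = (norm f)\<^sup>2 - (\<Sum>y\<in>F. (norm (ell2_apply f y))\<^sup>2)" if F: "finite F" for F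
  proof -
    define g where "g = f - s F"
    have sg: "cinner (s F) g = 0"
      unfolding s_def cinner_sum_left cinner_unit using s_apply[OF F]
      by (intro sum.neutral) (simp add: g_def)
    then have gs: "cinner g (s F) = 0" by (metis cinner_commute complex_cnj_zero)
    have "(norm (\<Sum>b\<in>UNIV. if b then g else s F))\<^sup>2 = (\<Sum>b\<in>UNIV. (norm (if b then g else s F))\<^sup>2)"
      by (rule norm_sum_orthogonal) (auto simp: sg gs)
    then have "(norm f)\<^sup>2 = (norm g)\<^sup>2 + (norm (s F))\<^sup>2"
      by (simp add: UNIV_bool g_def)
    moreover have "(norm (s F))\<^sup>2 = (\<Sum>y\<in>F. (norm (ell2_apply f y))\<^sup>2)"
      unfolding s_def by (rule norm_sum_unit[OF F])
    ultimately show ?thesis by (simp add: g_def norm_minus_commute)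
  qed
  have "((\<lambda>F. (norm f)\<^sup>2 - (\<Sum>y\<in>F. (norm (ell2_apply f y))\<^sup>2)) \<longlongrightarrow> (norm f)\<^sup>2 - (norm f)\<^sup>2)
      (finite_subsets_at_top UNIV)"
    using has_sum_norm_sq[of f] unfolding has_sum_def by (intro tendsto_diff tendsto_const)
  moreover have "\<forall>\<^sub>F F in finite_subsets_at_top UNIV.
      (norm f)\<^sup>2 - (\<Sum>y\<in>F. (norm (ell2_apply f y))\<^sup>2) = (norm (s F - f))\<^sup>2"
    by (rule eventually_finite_subsets_at_top_weakI) (simp only: nrm)
  ultimately have "((\<lambda>F. (norm (s F - f))\<^sup>2) \<longlongrightarrow> (norm f)\<^sup>2 - (norm f)\<^sup>2)
      (finite_subsets_at_top UNIV)"
    by (rule Lim_transform_eventually)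
  then have "((\<lambda>F. (norm (s F - f))\<^sup>2) \<longlongrightarrow> 0) (finite_subsets_at_top UNIV)" by simp
  then have "((\<lambda>F. sqrt ((norm (s F - f))\<^sup>2)) \<longlongrightarrow> sqrt 0) (finite_subsets_at_top UNIV)"
    by (rule tendsto_real_sqrt)
  then have "((\<lambda>F. s F - f) \<longlongrightarrow> 0) (finite_subsets_at_top UNIV)"
    by (simp add: tendsto_norm_zero_iff)
  then show ?thesis
    unfolding has_sum_def s_def[abs_def, symmetric] by (simp add: LIM_zero_iff)
qed

lemma summable_on_square_bound:
  fixes A :: "'i \<Rightarrow> 'h::banach" and g :: "'i \<Rightarrow> real"
  assumes g: "g summable_on UNIV" "\<And>i. 0 \<le> g i"
    and A: "\<And>F. finite F \<Longrightarrow> (norm (\<Sum>i\<in>F. A i))\<^sup>2 \<le> C * (\<Sum>i\<in>F. g i)" and C: "0 \<le> C"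
  shows "A summable_on UNIV"
proof -
  have "\<exists>P. eventually P (finite_subsets_at_top UNIV) \<and>
      (\<forall>F F'. P F \<and> P F' \<longrightarrow> dist (sum A F) (sum A F') < e)" if e: "0 < e" for e
  proof -
    define d where "d = (e / 4)\<^sup>2 / (C + 1)"
    have d: "0 < d" using e C by (simp add: d_def)
    have "(sum g \<longlongrightarrow> infsum g UNIV) (finite_subsets_at_top UNIV)"
      using has_sum_infsum[OF g(1)] by (simp only: has_sum_def)
    then have "\<forall>\<^sub>F F in finite_subsets_at_top UNIV. dist (sum g F) (infsum g UNIV) < d"
      using d by (rule tendstoD)
    then have "\<exists>X. finite X \<and> X \<subseteq> UNIV \<and>
        (\<forall>Y. finite Y \<and> X \<subseteq> Y \<and> Y \<subseteq> UNIV \<longrightarrow> dist (sum g Y) (infsum g UNIV) < d)"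
      by (rule eventually_finite_subsets_at_top[THEN iffD1])
    then obtain F0 where F0: "finite F0"
      "\<And>F. finite F \<Longrightarrow> F0 \<subseteq> F \<Longrightarrow> dist (sum g F) (infsum g UNIV) < d"
      by (elim exE conjE) (rule that, assumption, simp)
    have small: "norm (sum A F - sum A F0) < e / 2" if F: "finite F" "F0 \<subseteq> F" for F
    proof -
      have "sum g (F - F0) = sum g F - sum g F0"
        using F by (simp add: sum_diff)
      also have "\<dots> \<le> d"
      proof -
        have "sum g F \<le> infsum g UNIV"
          using g F by (intro finite_sum_le_infsum) auto
        moreover have "\<bar>sum g F0 - infsum g UNIV\<bar> < d"
          using F0(2)[OF F0(1) order_refl] unfolding dist_real_def .
        ultimately show ?thesis by linarith
      qed
      finally have gd: "sum g (F - F0) \<le> d" .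
      have "(norm (sum A F - sum A F0))\<^sup>2 = (norm (sum A (F - F0)))\<^sup>2"
        using F by (simp add: sum_diff)
      also have "\<dots> \<le> C * sum g (F - F0)" using A F(1) by blast
      also have "\<dots> \<le> (C + 1) * d"
        by (intro mult_mono gd sum_nonneg g(2)) (use C in linarith)+
      also have "\<dots> = (e / 4)\<^sup>2" using C by (simp add: d_def)
      finally have "(norm (sum A F - sum A F0))\<^sup>2 \<le> (e / 4)\<^sup>2" .
      then have "norm (sum A F - sum A F0) \<le> e / 4"
        by (rule power2_le_imp_le) (use e in simp)
      then show ?thesis using e by simp
    qed
    have "dist (sum A F) (sum A F') < e"
      if "finite F" "F0 \<subseteq> F" "finite F'" "F0 \<subseteq> F'" for F F'
      using small[OF that(1,2)] small[OF that(3,4)] dist_triangle2[of "sum A F" "sum A F'" "sum A F0"]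
      unfolding dist_norm by linarith
    moreover have "\<forall>\<^sub>F F in finite_subsets_at_top UNIV. finite F \<and> F0 \<subseteq> F"
      using F0(1) by (simp add: eventually_finite_subsets_at_top) (rule exI[of _ F0], simp)
    ultimately show ?thesis by (intro exI[of _ "\<lambda>F. finite F \<and> F0 \<subseteq> F"]) blast
  qed
  then have "cauchy_filter (filtermap (sum A) (finite_subsets_at_top UNIV))"
    by (simp add: cauchy_filter_metric_filtermap)
  moreover have "complete (UNIV :: 'h set)"
    by (meson Cauchy_convergent UNIV_I complete_def convergent_def)
  ultimately obtain L where "(sum A \<longlongrightarrow> L) (finite_subsets_at_top UNIV)"
    using complete_uniform[where S=UNIV] by (force simp add: filterlim_def)
  then show ?thesis by (auto simp: summable_on_def has_sum_def)
qed

lemma ampliation_ex1: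
  fixes A :: "('x, complex) ell2 \<Rightarrow>\<^sub>L ('x, complex) ell2"
  assumes A: "A \<in> bounded_operators"
  shows "\<exists>!T :: ('x, 'k::complex_hilbert) ell2 \<Rightarrow>\<^sub>L ('x, 'k) ell2. T \<in> bounded_operators \<and>
    (\<forall>f k. blinfun_apply T (elem_tensor f k) = elem_tensor (blinfun_apply A f) k)"
proof (rule ex_ex1I)
  define h where "h y = blinfun_apply A (unit_ell2 y)" for y
  define B where "B f y = elem_tensor (h y) (ell2_apply f y)" for f :: "('x, 'k) ell2" and y
  define T where "T f = infsum (B f) UNIV" for f
  have unit_scaleC: "a *\<^sub>C unit_ell2 y = elem_tensor (unit_ell2 y) a" for a and y :: 'x
    by (rule ell2_eqI) (simp add: scaleC_complex_def)
  have hb: "(norm (\<Sum>y\<in>F. a y *\<^sub>C h y))\<^sup>2 \<le> (norm A)\<^sup>2 * (\<Sum>y\<in>F. (cmod (a y))\<^sup>2)"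
    if F: "finite F" for F a
  proof -
    have "(\<Sum>y\<in>F. a y *\<^sub>C h y) = blinfun_apply A (\<Sum>y\<in>F. elem_tensor (unit_ell2 y) (a y))"
      using A by (simp add: h_def bounded_operators_def blinfun.sum_right flip: unit_scaleC)
    then have "norm (\<Sum>y\<in>F. a y *\<^sub>C h y) \<le> norm A * norm (\<Sum>y\<in>F. elem_tensor (unit_ell2 y) (a y))"
      by (simp add: norm_blinfun)
    then have "(norm (\<Sum>y\<in>F. a y *\<^sub>C h y))\<^sup>2
        \<le> (norm A * norm (\<Sum>y\<in>F. elem_tensor (unit_ell2 y) (a y)))\<^sup>2"
      by (intro power_mono) auto
    then show ?thesis by (simp add: power_mult_distrib norm_sum_unit[OF F])
  qed
  have Bb: "(norm (\<Sum>y\<in>F. B f y))\<^sup>2 \<le> (norm A)\<^sup>2 * (\<Sum>y\<in>F. (norm (ell2_apply f y))\<^sup>2)"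
    if F: "finite F" for F f
    unfolding B_def by (rule norm_sum_elem_tensor_le[OF F hb[OF F]])
  have Bs: "B f summable_on UNIV" for f
    by (rule summable_on_square_bound[where g="\<lambda>y. (norm (ell2_apply f y))\<^sup>2" and C="(norm A)\<^sup>2"])
      (use Bb square_summable_ell2_apply[of f] in \<open>auto simp: square_summable_def\<close>)
  then have Th: "(B f has_sum T f) UNIV" for f
    by (simp add: T_def)
  have Tn: "norm (T f) \<le> norm f * norm A" for f
  proof -
    have "norm (\<Sum>y\<in>F. B f y) \<le> norm A * norm f" if "finite F" for F
    proof -
      have "(\<Sum>y\<in>F. (norm (ell2_apply f y))\<^sup>2) \<le> (norm f)\<^sup>2"
        using has_sum_norm_sq[of f] that
        by (intro finite_sum_le_has_sum[of "\<lambda>x. (norm (ell2_apply f x))\<^sup>2"]) auto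
      then have "(norm (\<Sum>y\<in>F. B f y))\<^sup>2 \<le> (norm A * norm f)\<^sup>2"
        using Bb[OF that, of f] by (simp add: power_mult_distrib)
          (meson mult_left_mono order_trans zero_le_power2)
      then show ?thesis by (rule power2_le_imp_le) simp
    qed
    then have "\<forall>\<^sub>F F in finite_subsets_at_top UNIV. norm (\<Sum>y\<in>F. B f y) \<le> norm A * norm f"
      by (intro eventually_finite_subsets_at_top_weakI)
    moreover have "((\<lambda>F. norm (\<Sum>y\<in>F. B f y)) \<longlongrightarrow> norm (T f)) (finite_subsets_at_top UNIV)"
      using Th unfolding has_sum_def by (intro tendsto_norm)
    ultimately show ?thesis
      by (metis finite_subsets_at_top_neq_bot mult.commute tendsto_upperbound)
  qed
  have lin: "bounded_linear T"
  proof (rule bounded_linear_intro[where K="norm A"])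
    fix f g :: "('x, 'k) ell2" and r :: real
    have "(B (f + g) has_sum T f + T g) UNIV"
      using has_sum_add[OF Th[of f] Th[of g]] by (simp add: B_def[abs_def] elem_tensor_add_right)
    then show "T (f + g) = T f + T g" using Th has_sum_unique by blast
    have "((\<lambda>y. r *\<^sub>R B f y) has_sum r *\<^sub>R T f) UNIV"
      using has_sum_bounded_linear[OF bounded_linear_scaleR_right Th] by (simp add: comp_def)
    then have "(B (r *\<^sub>R f) has_sum r *\<^sub>R T f) UNIV"
      by (simp add: B_def[abs_def] elem_tensor_scaleR_right)
    then show "T (r *\<^sub>R f) = r *\<^sub>R T f" using Th has_sum_unique by blast
  qed (rule Tn)
  have blC: "bounded_linear (\<lambda>f. a *\<^sub>C (f :: ('x, 'k) ell2))" for a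
    by (rule bounded_linear_intro[where K="cmod a"])
      (auto simp: scaleC_add_right scaleC_scaleR mult.commute)
  have TC: "T (a *\<^sub>C f) = a *\<^sub>C T f" for a f
  proof -
    have "((\<lambda>y. a *\<^sub>C B f y) has_sum a *\<^sub>C T f) UNIV"
      using has_sum_bounded_linear[OF blC Th] by (simp add: comp_def)
    then have "(B (a *\<^sub>C f) has_sum a *\<^sub>C T f) UNIV"
      by (simp add: B_def[abs_def] elem_tensor_scaleC_right)
    then show ?thesis using Th has_sum_unique by blast
  qed
  have Tt: "T (elem_tensor f k) = elem_tensor (blinfun_apply A f) k" for f k
  proof -
    have "((\<lambda>y. elem_tensor (unit_ell2 y) (ell2_apply f y)) has_sum f) UNIV"
      by (rule has_sum_unit)
    then have "((\<lambda>y. elem_tensor (blinfun_apply A (ell2_apply f y *\<^sub>C unit_ell2 y)) k)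
        has_sum elem_tensor (blinfun_apply A f) k) UNIV"
      using has_sum_bounded_linear[OF bounded_linear_compose[OF bounded_linear_elem_tensor_left[of k]
            blinfun.bounded_linear_right[of A]]]
      by (fastforce simp: comp_def unit_scaleC)
    moreover have "elem_tensor (blinfun_apply A (a *\<^sub>C unit_ell2 y)) k = elem_tensor (h y) (a *\<^sub>C k)" for a y
      using A by (simp add: bounded_operators_def h_def elem_tensor_scaleC_left elem_tensor_scaleC_right)
    ultimately have "(B (elem_tensor f k) has_sum elem_tensor (blinfun_apply A f) k) UNIV"
      by (simp add: B_def[abs_def])
    then show ?thesis using Th has_sum_unique by blast
  qed
  show "\<exists>T :: ('x, 'k) ell2 \<Rightarrow>\<^sub>L ('x, 'k) ell2. T \<in> bounded_operators \<and>
    (\<forall>f k. blinfun_apply T (elem_tensor f k) = elem_tensor (blinfun_apply A f) k)"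
    by (rule exI[of _ "Blinfun T"]) (simp add: bounded_operators_def bounded_linear_Blinfun_apply[OF lin] TC Tt)
next
  fix S T :: "('x, 'k) ell2 \<Rightarrow>\<^sub>L ('x, 'k) ell2"
  assume S: "S \<in> bounded_operators \<and>
      (\<forall>f k. blinfun_apply S (elem_tensor f k) = elem_tensor (blinfun_apply A f) k)"
    and T: "T \<in> bounded_operators \<and>
      (\<forall>f k. blinfun_apply T (elem_tensor f k) = elem_tensor (blinfun_apply A f) k)"
  show "S = T"
  proof (rule blinfun_eqI)
    fix f
    note has_sum_bounded_linear[OF blinfun.bounded_linear_right has_sum_unit[of f], unfolded comp_def]
    from this[of S] this[of T] show "blinfun_apply S f = blinfun_apply T f"
      using S T by (auto intro: has_sum_unique)
  qed
qed

text \<open>\<open>ampliation A\<close> is $A \otimes I$ on $l^2(X) \otimes \mathcal K \cong l^2(X, \mathcal K)$, where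
  \<open>elem_tensor f k\<close> is $f \otimes k$. Existence and uniqueness are \<open>ampliation_ex1\<close>.\<close>

definition ampliation ::
  "(('x, complex) ell2 \<Rightarrow>\<^sub>L ('x, complex) ell2) \<Rightarrow> ('x, 'k::complex_hilbert) ell2 \<Rightarrow>\<^sub>L ('x, 'k) ell2"
  where "ampliation A = (THE T. T \<in> bounded_operators \<and>
    (\<forall>f k. blinfun_apply T (elem_tensor f k) = elem_tensor (blinfun_apply A f) k))"

lemma ampliation:
  assumes "A \<in> bounded_operators"
  shows "ampliation A \<in> bounded_operators"
    and "blinfun_apply (ampliation A) (elem_tensor f k) = elem_tensor (blinfun_apply A f) k"
  using theI'[OF ampliation_ex1[OF assms]] unfolding ampliation_def by blast+

end

theory Submission
  imports Defs
begin

text \<open>Suppose that $z \notin \mathrm{Spec}(H)$, with resolvent $S$. Since $H_0$ commutes with the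
  translations, conjugating $H$ by $U_\gamma$ turns $V$ into the translated potential
  $x \mapsto V(\gamma x)$ and leaves $H_0$ alone, so every $H_0 + V(\gamma\,\cdot)$ has a resolvent
  at $z$ of norm at most $\|S\|$ (\<open>resolvent_translate\<close>). By pseudo-ergodicity these translated
  potentials approximate $W$ on any prescribed finite set. The theorem therefore reduces to a
  statement without a group (\<open>resolvent_of_local_limit\<close>): if $W$ is approximated on finite sets by
  uniformly bounded potentials $Q$ for which the resolvents of $A + Q$ at $z$ are uniformly bounded,
  then $A + W$ has a resolvent at $z$.

  Such $Q$ converge to $W$ strongly but not in norm. The point is that a potential is a diagonal
  operator: if $D = W - Q$ is bounded and small on a large finite set, then, for a fixed vector $f$,
  both $Df$ is small and $\langle f, Dh \rangle$ is small uniformly in $\|h\| \le 1$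
  (\<open>potential_op_small\<close>). The first fact carries the lower bound for $A + Q - z$ over to
  $A + W - z$. The second gives dense range without adjoints: with $S$ the resolvent of
  $A + Q$, the vector $y = (A + W - z) S g = g + D S g$ has norm at most $\beta \|g\|$ and almost
  the inner product $\|g\|^2$ with $g$, so subtracting a small multiple of $y$ from $g$
  shortens $g$ by a factor $q < 1$ that does not depend on $g$. A subspace with this property is
  dense (\<open>dense_if_approx_factor\<close>), and an operator that is bounded below with dense range is
  invertible (\<open>resolvent_exists\<close>).\<close>

section \<open>Bounded operators and resolvents\<close>

definition is_resolvent ::
  "complex \<Rightarrow> ('h::complex_inner \<Rightarrow>\<^sub>L 'h) \<Rightarrow> ('h \<Rightarrow>\<^sub>L 'h) \<Rightarrow> bool" where
  "is_resolvent z T S \<longleftrightarrow> S \<in> bounded_operators \<and>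
    (\<forall>f. blinfun_apply S (blinfun_apply T f - z *\<^sub>C f) = f \<and>
      blinfun_apply T (blinfun_apply S f) - z *\<^sub>C blinfun_apply S f = f)"

lemma notin_Spec_iff: "z \<notin> Spec T \<longleftrightarrow> (\<exists>S. is_resolvent z T S)"
  unfolding Spec_def is_resolvent_def by blast

lemma bounded_operators_scaleC:
  "T \<in> bounded_operators \<Longrightarrow> blinfun_apply T (a *\<^sub>C f) = a *\<^sub>C blinfun_apply T f"
  by (simp add: bounded_operators_def)

lemma bounded_linear_scaleC_right: "bounded_linear (\<lambda>f. a *\<^sub>C (f :: 'h::complex_inner))"
  by (rule bounded_linear_intro[where K="cmod a"])
    (auto simp: scaleC_add_right scaleC_scaleR mult.commute)

lemma norm_diff_scaleR_sq:
  fixes g y :: "'h::complex_inner"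
  shows "(norm (g - t *\<^sub>R y))\<^sup>2 = (norm g)\<^sup>2 - 2 * t * Re (cinner g y) + t\<^sup>2 * (norm y)\<^sup>2"
proof -
  define u where "u = complex_of_real (- t) *\<^sub>C y"
  have u: "g - t *\<^sub>R y = g + u"
    unfolding u_def scaleC_of_real by simp
  have "Re (cinner (g + u) (g + u)) =
      Re (cinner g g) + Re (cinner u u) + (Re (cinner g u) + Re (cinner u g))"
    by (simp add: cinner_add_left cinner_add_right)
  moreover have "Re (cinner u g) = Re (cinner g u)"
    by (subst cinner_commute) simp
  moreover have "Re (cinner g u) = - t * Re (cinner g y)"
    by (simp add: u_def cinner_scaleC_right)
  moreover have "norm u = \<bar>t\<bar> * norm y"
    by (simp add: u_def)
  ultimately show ?thesis
    unfolding u by (simp add: cinner_self power_mult_distrib)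
qed

text \<open>The distance $d$ from $g$ to $Y$ does not change when an element of $Y$ is subtracted from $g$.
  The hypothesis for $g - y$ therefore gives $d \le q \|g - y\|$ for every $y \in Y$; the infimum
  over $y$ is $d \le q d$, so $d = 0$.\<close>

lemma dense_if_approx_factor:
  fixes Y :: "'h::real_normed_vector set"
  assumes Y: "subspace Y" and q: "0 < q" "q < 1"
    and approx: "\<And>g. g \<noteq> 0 \<Longrightarrow> \<exists>y\<in>Y. norm (g - y) \<le> q * norm g"
  shows "closure Y = UNIV"
proof -
  have "infdist g Y = 0" for g
  proof (rule ccontr)
    assume "infdist g Y \<noteq> 0"
    then have d: "0 < infdist g Y" using infdist_nonneg[of g Y] by linarith
    have ne: "Y \<noteq> {}" using Y subspace_0 by blast
    have le: "infdist g Y \<le> q * dist g y" if "y \<in> Y" for y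
    proof (cases "g - y = 0")
      case True
      then show ?thesis using d that infdist_zero[of g Y] by simp
    next
      case False
      then obtain y' where y': "y' \<in> Y" "norm (g - y - y') \<le> q * norm (g - y)"
        using approx by blast
      have "infdist g Y \<le> dist g (y + y')"
        by (intro infdist_le subspace_add Y that y')
      also have "\<dots> = norm (g - y - y')" by (simp add: dist_norm algebra_simps)
      finally show ?thesis using y'(2) by (simp add: dist_norm)
    qed
    have "infdist g Y / q \<le> (INF y\<in>Y. dist g y)"
      using ne le q(1) by (intro cINF_greatest) (auto simp: divide_le_eq mult.commute)
    then have "infdist g Y \<le> q * infdist g Y"
      using q(1) ne by (simp add: infdist_notempty divide_le_eq mult.commute)
    then show False using mult_strict_right_mono[OF q(2) d] by simp
  qed
  moreover have "Y \<noteq> {}" using Y subspace_0 by blast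
  ultimately have "g \<in> closure Y" for g
    using in_closure_iff_infdist_zero[of Y g] by blast
  then show ?thesis by blast
qed

text \<open>Boundedness below makes $T - z$ injective with complete, hence closed, range, and it bounds the
  inverse.\<close>

lemma resolvent_exists:
  fixes T :: "'h::complex_hilbert \<Rightarrow>\<^sub>L 'h"
  assumes T: "T \<in> bounded_operators"
    and below: "\<And>f. norm f \<le> c * norm (blinfun_apply T f - z *\<^sub>C f)"
    and dense: "closure (range (\<lambda>f. blinfun_apply T f - z *\<^sub>C f)) = UNIV"
  shows "\<exists>S. is_resolvent z T S"
proof -
  define A where "A f = blinfun_apply T f - z *\<^sub>C f" for f
  define b where "b = max c 1"
  have b: "0 < b" by (simp add: b_def)
  have lin: "bounded_linear A"
    unfolding A_def by (intro bounded_linear_sub blinfun.bounded_linear_right bounded_linear_scaleC_right)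
  interpret A: bounded_linear A by (rule lin)
  have AC: "A (a *\<^sub>C f) = a *\<^sub>C A f" for a f
    by (simp add: A_def bounded_operators_scaleC[OF T] scaleC_diff_right scaleC_scaleC mult.commute)
  have bel: "norm f \<le> b * norm (A f)" for f
  proof -
    have "c * norm (A f) \<le> b * norm (A f)" by (intro mult_right_mono) (auto simp: b_def)
    then show ?thesis using below[of f] by (simp add: A_def)
  qed
  have "complete (A ` UNIV)"
  proof (rule complete_isometric_image[where e="inverse b"])
    show "complete (UNIV :: 'h set)" by (rule complete_UNIV)
    show "\<forall>x\<in>UNIV. inverse b * norm x \<le> norm (A x)"
      using bel b by (simp add: field_simps)
  qed (use b lin in auto)
  then have "closed (range A)" by (rule complete_imp_closed)
  then have surj: "range A = UNIV"
    using dense by (simp add: A_def[abs_def] closure_closed)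
  have inj: "inj A"
  proof (rule injI)
    fix f g assume "A f = A g"
    then have "norm (f - g) \<le> 0" using bel[of "f - g"] by (simp add: A.diff)
    then show "f = g" by simp
  qed
  define R where "R = inv_into UNIV A"
  have RA: "R (A f) = f" and AR: "A (R f) = f" for f
    using surj inj by (simp_all add: R_def surj_f_inv_f)
  have R_eqI: "A h = f \<Longrightarrow> R f = h" for f h using RA by blast
  have "bounded_linear R"
  proof (rule bounded_linear_intro[where K=b])
    show "R (f + g) = R f + R g" for f g by (rule R_eqI) (simp add: A.add AR)
    show "R (r *\<^sub>R f) = r *\<^sub>R R f" for r f by (rule R_eqI) (simp add: A.scaleR AR)
    show "norm (R f) \<le> norm f * b" for f using bel[of "R f"] by (simp add: AR mult.commute)
  qed
  then have R: "blinfun_apply (Blinfun R) = R" by (rule bounded_linear_Blinfun_apply)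
  have "R (a *\<^sub>C f) = a *\<^sub>C R f" for a f by (rule R_eqI) (simp add: AC AR)
  then have "is_resolvent z T (Blinfun R)"
    using RA AR by (simp add: is_resolvent_def bounded_operators_def R A_def)
  then show ?thesis by blast
qed

text \<open>The relation $T U = U T'$ with $U$ invertible says $T' = U^{-1} T U$, and $U^{-1} S U$ is the
  resolvent of $T'$.\<close>

lemma resolvent_conjugate:
  fixes T T' U U' S :: "'h::complex_inner \<Rightarrow>\<^sub>L 'h"
  assumes S: "is_resolvent z T S"
    and UU: "U \<in> bounded_operators" "U' \<in> bounded_operators"
    and U'U: "\<And>f. blinfun_apply U' (blinfun_apply U f) = f"
    and UU': "\<And>f. blinfun_apply U (blinfun_apply U' f) = f"
    and iso: "\<And>f. norm (blinfun_apply U f) = norm f" "\<And>f. norm (blinfun_apply U' f) = norm f"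
    and inter: "\<And>f. blinfun_apply T (blinfun_apply U f) = blinfun_apply U (blinfun_apply T' f)"
  shows "\<exists>S'. is_resolvent z T' S' \<and> norm S' \<le> norm S"
proof (intro exI conjI)
  let ?S' = "U' o\<^sub>L (S o\<^sub>L U)"
  note sc = bounded_operators_scaleC
  have SB: "S \<in> bounded_operators"
    and S1: "\<And>f. blinfun_apply S (blinfun_apply T f - z *\<^sub>C f) = f"
    and S2: "\<And>f. blinfun_apply T (blinfun_apply S f) - z *\<^sub>C blinfun_apply S f = f"
    using S by (auto simp: is_resolvent_def)
  have inter': "blinfun_apply T' (blinfun_apply U' f) = blinfun_apply U' (blinfun_apply T f)" for f
    by (metis inter U'U UU')
  show "is_resolvent z T' ?S'"
    unfolding is_resolvent_def
  proof (intro conjI allI)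
    show "?S' \<in> bounded_operators"
      by (simp add: bounded_operators_def sc[OF SB] sc[OF UU(1)] sc[OF UU(2)])
    fix f
    have "blinfun_apply U (blinfun_apply T' f - z *\<^sub>C f)
        = blinfun_apply T (blinfun_apply U f) - z *\<^sub>C blinfun_apply U f"
      by (simp add: blinfun.diff_right sc[OF UU(1)] inter)
    then show "blinfun_apply ?S' (blinfun_apply T' f - z *\<^sub>C f) = f"
      by (simp add: S1 U'U)
    have "blinfun_apply T' (blinfun_apply ?S' f) - z *\<^sub>C blinfun_apply ?S' f
        = blinfun_apply U' (blinfun_apply T (blinfun_apply S (blinfun_apply U f))
            - z *\<^sub>C blinfun_apply S (blinfun_apply U f))"
      by (simp add: blinfun.diff_right sc[OF UU(2)] inter')
    then show "blinfun_apply T' (blinfun_apply ?S' f) - z *\<^sub>C blinfun_apply ?S' f = f"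
      by (simp add: S2 U'U)
  qed
  show "norm ?S' \<le> norm S"
  proof (rule norm_blinfun_bound)
    fix f
    show "norm (blinfun_apply ?S' f) \<le> norm S * norm f"
      using norm_blinfun[of S "blinfun_apply U f"] by (simp add: iso)
  qed simp
qed

section \<open>Truncation to finite sets and potentials\<close>

lemma norm_ell2_le_pointwise:
  fixes f g :: "('x, 'k::complex_inner) ell2"
  assumes "\<And>x. norm (ell2_apply g x) \<le> C * norm (ell2_apply f x)" "0 \<le> C"
  shows "norm g \<le> C * norm f"
  unfolding norm_ell2.rep_eq using assms by (intro ell2_norm_le) auto

definition trunc :: "'x set \<Rightarrow> ('x, 'k::complex_inner) ell2 \<Rightarrow> ('x, 'k) ell2" where
  "trunc F f = (\<Sum>y\<in>F. elem_tensor (unit_ell2 y) (ell2_apply f y))"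

lemma trunc_apply:
  assumes "finite F"
  shows "ell2_apply (trunc F f) x = (if x \<in> F then ell2_apply f x else 0)"
proof -
  have "ell2_apply (trunc F f) x = (\<Sum>y\<in>F. if x = y then ell2_apply f y else 0)"
    unfolding trunc_def ell2_apply_sum by (intro sum.cong refl) simp
  then show ?thesis using assms by simp
qed

lemma norm_trunc_le: "finite F \<Longrightarrow> norm (trunc F f) \<le> norm f"
  using norm_ell2_le_pointwise[of "trunc F f" 1 f] by (simp add: trunc_apply)

text \<open>Truncation is the orthogonal projection onto the vectors supported in \<open>F\<close>. Its
  self-adjointness replaces the adjoint of the potential in the estimate below.\<close>

lemma cinner_trunc_left:
  assumes "finite F"
  shows "cinner (trunc F f) h = cinner (trunc F f) (trunc F h)"
proof -
  have "cinner (trunc F f) h = (\<Sum>y\<in>F. cinner (ell2_apply f y) (ell2_apply h y))" for h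
    by (simp add: trunc_def cinner_sum_left cinner_unit)
  from this[of h] this[of "trunc F h"] show ?thesis
    using assms by (simp add: trunc_apply)
qed

lemma trunc_approx:
  assumes "0 < e"
  obtains F where "finite F" "norm (f - trunc F f) < e"
proof -
  have "((\<lambda>F. trunc F f) \<longlongrightarrow> f) (finite_subsets_at_top UNIV)"
    using has_sum_unit[of f] by (simp add: has_sum_def trunc_def)
  then have "\<forall>\<^sub>F F in finite_subsets_at_top UNIV. dist (trunc F f) f < e"
    using assms by (rule tendstoD)
  then obtain F where "finite F" "dist (trunc F f) f < e"
    by (auto simp: eventually_finite_subsets_at_top)
  then show ?thesis using that by (simp add: dist_norm norm_minus_commute)
qed

lemma norm_blinfun_le: "norm T \<le> C \<Longrightarrow> norm (blinfun_apply T k) \<le> C * norm k"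
  by (meson mult_right_mono norm_blinfun norm_ge_zero order_trans)

lemma norm_potential_op_le:
  assumes "\<And>x. norm (D x) \<le> C" "0 \<le> C"
  shows "norm (blinfun_apply (potential_op D) f) \<le> C * norm f"
proof -
  have "bounded (range D)" using assms(1) by (auto simp: bounded_iff)
  then show ?thesis
    using assms by (intro norm_ell2_le_pointwise) (auto simp: potential_op_apply norm_blinfun_le)
qed

text \<open>A potential commutes with truncation, so only its values on \<open>F\<close> matter, on whichever side of it
  the truncation stands.\<close>

lemma potential_op_trunc_le:
  assumes D: "bounded (range D)" and F: "finite F"
    and small: "\<And>x. x \<in> F \<Longrightarrow> norm (D x) \<le> e" and e: "0 \<le> e"
  shows "norm (blinfun_apply (potential_op D) (trunc F f)) \<le> e * norm f"
    and "norm (trunc F (blinfun_apply (potential_op D) f)) \<le> e * norm f"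
  using e by (intro norm_ell2_le_pointwise;
      auto simp: potential_op_apply[OF D] trunc_apply[OF F] intro: norm_blinfun_le small)+

text \<open>Split $f$ into its truncation to a large finite set $F$ and a small tail. On the tail the crude
  bound $\|D\| \le C$ suffices; on the truncation only the values of $D$ on $F$ are seen, in $Df$
  directly and in $\langle f, Dh \rangle$ by moving the truncation to the other side.\<close>

lemma potential_op_small:
  fixes f :: "('x, 'k::complex_inner) ell2"
  assumes "0 < \<eta>" and C: "0 \<le> C"
  obtains F \<epsilon> where "finite F" "0 < \<epsilon>"
    "\<And>D. (\<And>x. norm (D x) \<le> C) \<Longrightarrow> (\<And>x. x \<in> F \<Longrightarrow> norm (D x) \<le> \<epsilon>) \<Longrightarrow>
      norm (blinfun_apply (potential_op D) f) \<le> \<eta> \<and>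
      (\<forall>h. cmod (cinner f (blinfun_apply (potential_op D) h)) \<le> \<eta> * norm h)"
proof -
  define \<epsilon> where "\<epsilon> = \<eta> / (2 * (norm f + 1))"
  have "0 < norm f + 1" using norm_ge_zero[of f] by linarith
  then have \<epsilon>: "0 < \<epsilon>" "\<epsilon> * norm f \<le> \<eta> / 2"
    using assms(1) by (simp_all add: \<epsilon>_def field_simps)
  obtain F where F: "finite F" "norm (f - trunc F f) < \<eta> / (2 * (C + 1))"
    using trunc_approx[of "\<eta> / (2 * (C + 1))" f] assms by auto
  have tail: "C * norm (f - trunc F f) \<le> \<eta> / 2"
  proof -
    have "C * norm (f - trunc F f) \<le> (C + 1) * (\<eta> / (2 * (C + 1)))"
      using F(2) C by (intro mult_mono) auto
    also have "\<dots> = \<eta> / 2" using C by (simp add: field_simps)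
    finally show ?thesis .
  qed
  show thesis
  proof (rule that[OF F(1) \<epsilon>(1)])
    fix D :: "'x \<Rightarrow> 'k \<Rightarrow>\<^sub>L 'k"
    assume D: "\<And>x. norm (D x) \<le> C" and DF: "\<And>x. x \<in> F \<Longrightarrow> norm (D x) \<le> \<epsilon>"
    let ?D = "blinfun_apply (potential_op D)"
    have bD: "bounded (range D)" using D by (auto simp: bounded_iff)
    note near = potential_op_trunc_le[OF bD F(1) DF less_imp_le[OF \<epsilon>(1)]]
    have split: "f = trunc F f + (f - trunc F f)" by simp
    have "norm (?D f) \<le> norm (?D (trunc F f)) + norm (?D (f - trunc F f))"
      by (subst (1) split, subst blinfun.add_right) (rule norm_triangle_ineq)
    also have "\<dots> \<le> \<epsilon> * norm f + C * norm (f - trunc F f)"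
      by (intro add_mono near norm_potential_op_le D C)
    finally have 1: "norm (?D f) \<le> \<eta>" using \<epsilon>(2) tail by linarith
    have 2: "cmod (cinner f (?D h)) \<le> \<eta> * norm h" for h
    proof -
      have "cinner f (?D h) = cinner (trunc F f) (trunc F (?D h)) + cinner (f - trunc F f) (?D h)"
        by (subst split, subst cinner_add_left, subst cinner_trunc_left[OF F(1)]) (rule refl)
      also have "cmod \<dots> \<le> norm (trunc F f) * norm (trunc F (?D h))
          + norm (f - trunc F f) * norm (?D h)"
        by (intro order_trans[OF norm_triangle_ineq] add_mono cinner_cauchy_schwarz)
      also have "\<dots> \<le> norm f * (\<epsilon> * norm h) + norm (f - trunc F f) * (C * norm h)"
        by (intro add_mono mult_mono norm_trunc_le F near norm_potential_op_le D C order_refl) auto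
      also have "\<dots> = (\<epsilon> * norm f + C * norm (f - trunc F f)) * norm h"
        by (simp add: algebra_simps)
      also have "\<dots> \<le> \<eta> * norm h"
        using \<epsilon>(2) tail by (intro mult_right_mono) auto
      finally show ?thesis .
    qed
    show "norm (?D f) \<le> \<eta> \<and> (\<forall>h. cmod (cinner f (?D h)) \<le> \<eta> * norm h)"
      using 1 2 by blast
  qed
qed

lemma potential_op_diff:
  assumes "\<And>x. norm (W x) \<le> C" "\<And>x. norm (Q x) \<le> C"
  shows "blinfun_apply (potential_op W) f - blinfun_apply (potential_op Q) f
    = blinfun_apply (potential_op (\<lambda>x. W x - Q x)) f"
proof -
  have "norm (W x - Q x) \<le> C + C" for x
    by (rule order_trans[OF norm_triangle_ineq4]) (intro add_mono assms)
  then have "bounded (range W)" "bounded (range Q)" "bounded (range (\<lambda>x. W x - Q x))"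
    using assms unfolding bounded_iff by blast+
  then show ?thesis by (intro ell2_eqI) (simp add: potential_op_apply blinfun.diff_left)
qed

lemma potential_op_bounded_operators:
  assumes "bounded (range V)" "\<And>x. V x \<in> bounded_operators"
  shows "potential_op V \<in> bounded_operators"
  unfolding bounded_operators_def
  by (auto intro!: ell2_eqI simp: potential_op_apply[OF assms(1)] bounded_operators_scaleC[OF assms(2)])

section \<open>Resolvents under local approximation of the potential\<close>

text \<open>Uniformity of the bound \<open>r\<close> is essential: it makes $\|f\| \le r \|(A + W - z) f\|$ survive
  the limit and makes the contraction factor in the proof of dense range independent of the vector.\<close>

lemma resolvent_of_local_limit:
  fixes A :: "('x, 'k::complex_hilbert) ell2 \<Rightarrow>\<^sub>L ('x, 'k) ell2"
  assumes A: "A \<in> bounded_operators"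
    and W: "\<And>x. norm (W x) \<le> C" "\<And>x. W x \<in> bounded_operators"
    and approx: "\<And>F \<epsilon>. finite F \<Longrightarrow> 0 < \<epsilon> \<Longrightarrow> \<exists>Q S. (\<forall>x. norm (Q x) \<le> C) \<and>
      (\<forall>x\<in>F. norm (W x - Q x) \<le> \<epsilon>) \<and> is_resolvent z (A + potential_op Q) S \<and> norm S \<le> r"
  shows "\<exists>S. is_resolvent z (A + potential_op W) S"
proof -
  let ?K = "A + potential_op W"
  define L where "L f = blinfun_apply ?K f - z *\<^sub>C f" for f
  have C: "0 \<le> C" using W(1) norm_ge_zero order_trans by blast
  have r: "0 \<le> r"
  proof -
    obtain S :: "('x, 'k) ell2 \<Rightarrow>\<^sub>L ('x, 'k) ell2" where "norm S \<le> r"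
      using approx[of "{}" 1] by auto
    then show ?thesis using norm_ge_zero[of S] by linarith
  qed
  \<comment> \<open>The two identities express $A + Q = (A + W) - D$ for $D = W - Q$, with \<open>S\<close> the resolvent of
    $A + Q$; the potential \<open>Q\<close> itself is not mentioned again.\<close>
  have perturb: "\<exists>D S. (\<forall>x. norm (D x) \<le> 2 * C) \<and> norm S \<le> r \<and>
      norm (blinfun_apply (potential_op D) f) \<le> \<eta> \<and>
      (\<forall>h. cmod (cinner f (blinfun_apply (potential_op D) h)) \<le> \<eta> * norm h) \<and>
      (\<forall>h. h = blinfun_apply S (L h - blinfun_apply (potential_op D) h)) \<and>
      (\<forall>h. L (blinfun_apply S h) = h + blinfun_apply (potential_op D) (blinfun_apply S h))"
    if \<eta>: "0 < \<eta>" for f \<eta>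
  proof -
    obtain F \<epsilon> where F: "finite F" "0 < \<epsilon>" and small:
      "\<And>D. (\<And>x. norm (D x) \<le> 2 * C) \<Longrightarrow> (\<And>x. x \<in> F \<Longrightarrow> norm (D x) \<le> \<epsilon>) \<Longrightarrow>
        norm (blinfun_apply (potential_op D) f) \<le> \<eta> \<and>
        (\<forall>h. cmod (cinner f (blinfun_apply (potential_op D) h)) \<le> \<eta> * norm h)"
      using potential_op_small[OF \<eta>, of "2 * C" f] C by (metis mult_nonneg_nonneg zero_le_numeral)
    obtain Q S where Q: "\<And>x. norm (Q x) \<le> C" "\<And>x. x \<in> F \<Longrightarrow> norm (W x - Q x) \<le> \<epsilon>"
      and S: "is_resolvent z (A + potential_op Q) S" "norm S \<le> r"
      using approx[OF F] by blast
    define D where "D x = W x - Q x" for x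
    have D: "norm (D x) \<le> 2 * C" for x
      using norm_triangle_ineq4[of "W x" "Q x"] W(1)[of x] Q(1)[of x] by (simp add: D_def)
    have DD: "blinfun_apply (potential_op W) h
        = blinfun_apply (potential_op Q) h + blinfun_apply (potential_op D) h" for h
      using potential_op_diff[where f=h, OF W(1) Q(1)] by (simp add: D_def[abs_def] algebra_simps)
    have Lh: "L h = (blinfun_apply (A + potential_op Q) h - z *\<^sub>C h)
        + blinfun_apply (potential_op D) h" for h
      by (simp add: L_def DD blinfun.add_left)
    have S1: "h = blinfun_apply S (L h - blinfun_apply (potential_op D) h)" for h
      using S(1) unfolding Lh is_resolvent_def by simp
    have S2: "L (blinfun_apply S h) = h + blinfun_apply (potential_op D) (blinfun_apply S h)" for h
      using S(1) unfolding Lh is_resolvent_def by simp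
    have "norm (blinfun_apply (potential_op D) f) \<le> \<eta> \<and>
        (\<forall>h. cmod (cinner f (blinfun_apply (potential_op D) h)) \<le> \<eta> * norm h)"
      by (rule small) (use D Q(2) in \<open>auto simp: D_def\<close>)
    with D S(2) S1 S2 show ?thesis by blast
  qed
  have below: "norm f \<le> r * norm (L f)" for f
  proof (rule field_le_epsilon)
    fix e :: real assume e: "0 < e"
    define \<eta> where "\<eta> = e / (r + 1)"
    have \<eta>: "0 < \<eta>" using e r by (simp add: \<eta>_def)
    obtain D S where S: "norm S \<le> r" and Df: "norm (blinfun_apply (potential_op D) f) \<le> \<eta>"
      and f: "f = blinfun_apply S (L f - blinfun_apply (potential_op D) f)"
      using perturb[OF \<eta>, of f] by blast
    have "norm f \<le> r * norm (L f - blinfun_apply (potential_op D) f)"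
      by (subst f) (rule norm_blinfun_le[OF S])
    also have "\<dots> \<le> r * (norm (L f) + \<eta>)"
      using Df r norm_triangle_ineq4[of "L f" "blinfun_apply (potential_op D) f"]
      by (intro mult_left_mono) auto
    also have "\<dots> = r * norm (L f) + r * \<eta>" by (simp add: algebra_simps)
    also have "r * \<eta> \<le> e" using e r by (simp add: \<eta>_def field_simps)
    finally show "norm f \<le> r * norm (L f) + e" by simp
  qed
  \<comment> \<open>$\beta$ bounds $\|y\| / \|g\|$ for $y = g + D S g$ with $\|D\| \le 2C$ and $\|S\| \le r$.\<close>
  define \<beta> where "\<beta> = 1 + 2 * C * r"
  have \<beta>: "1 \<le> \<beta>" using C r by (simp add: \<beta>_def)
  define q where "q = sqrt (1 - 1 / (2 * \<beta>\<^sup>2))"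
  have \<beta>2: "1 \<le> \<beta>\<^sup>2" using \<beta> by (simp add: one_le_power)
  have q: "0 < q" "q < 1" "q\<^sup>2 = 1 - 1 / (2 * \<beta>\<^sup>2)"
  proof -
    have "1 / (2 * \<beta>\<^sup>2) \<le> 1 / 2" "0 < 1 / (2 * \<beta>\<^sup>2)"
      using \<beta>2 \<beta> by (simp_all add: divide_le_eq)
    then show "0 < q" "q < 1" "q\<^sup>2 = 1 - 1 / (2 * \<beta>\<^sup>2)"
      by (auto simp: q_def)
  qed
  have near: "\<exists>y\<in>range L. norm (g - y) \<le> q * norm g" if g: "g \<noteq> 0" for g
  proof -
    define \<eta> where "\<eta> = norm g / (4 * (r + 1))"
    have \<eta>: "0 < \<eta>" using g r by (simp add: \<eta>_def)
    obtain D S where S: "norm S \<le> r" and D: "\<And>x. norm (D x) \<le> 2 * C"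
      and gD: "\<And>h. cmod (cinner g (blinfun_apply (potential_op D) h)) \<le> \<eta> * norm h"
      and LS: "\<And>h. L (blinfun_apply S h) = h + blinfun_apply (potential_op D) (blinfun_apply S h)"
      using perturb[OF \<eta>, of g] by blast
    define y where "y = L (blinfun_apply S g)"
    \<comment> \<open>If $\mathrm{Re} \langle g, y \rangle = \|g\|^2$ held, $t = \beta^{-2}$ would minimise the
      bound $(1 - 2t + t^2 \beta^2) \|g\|^2$ for $\|g - t y\|^2$; losing a quarter in the inner product
      still leaves $(1 - \frac{3}{2} t + t) \|g\|^2 = q^2 \|g\|^2$.\<close>
    define t where "t = 1 / \<beta>\<^sup>2"
    have Sg: "norm (blinfun_apply S g) \<le> r * norm g" by (rule norm_blinfun_le[OF S])
    have "norm (blinfun_apply (potential_op D) (blinfun_apply S g)) \<le> 2 * C * (r * norm g)"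
      by (rule order_trans[OF norm_potential_op_le[OF D]]) (use C Sg in \<open>auto intro: mult_left_mono\<close>)
    then have ny: "norm y \<le> \<beta> * norm g"
      unfolding y_def LS \<beta>_def
      using norm_triangle_ineq[of g "blinfun_apply (potential_op D) (blinfun_apply S g)"]
      by (simp add: algebra_simps)
    have "cmod (cinner g (blinfun_apply (potential_op D) (blinfun_apply S g))) \<le> \<eta> * (r * norm g)"
      using \<eta> by (intro order_trans[OF gD] mult_left_mono Sg) simp
    also have "\<dots> \<le> (norm g)\<^sup>2 / 4"
      using r by (simp add: \<eta>_def field_simps power2_eq_square)
    finally have "\<bar>Re (cinner g (blinfun_apply (potential_op D) (blinfun_apply S g)))\<bar> \<le> (norm g)\<^sup>2 / 4"
      using abs_Re_le_cmod order_trans by blast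
    then have re: "3 / 4 * (norm g)\<^sup>2 \<le> Re (cinner g y)"
      by (simp add: y_def LS cinner_add_right cinner_self)
    have t: "0 < t" "t\<^sup>2 * \<beta>\<^sup>2 = t" "q\<^sup>2 = 1 - t / 2"
      using \<beta> q(3) by (auto simp: t_def power2_eq_square)
    have "(norm (g - t *\<^sub>R y))\<^sup>2 = (norm g)\<^sup>2 - 2 * t * Re (cinner g y) + t\<^sup>2 * (norm y)\<^sup>2"
      by (rule norm_diff_scaleR_sq)
    also have "\<dots> \<le> (norm g)\<^sup>2 - 2 * t * (3 / 4 * (norm g)\<^sup>2) + t\<^sup>2 * (\<beta> * norm g)\<^sup>2"
      using t re ny by (intro add_mono diff_mono mult_left_mono power_mono order_refl) auto
    also have "t\<^sup>2 * (\<beta> * norm g)\<^sup>2 = t * (norm g)\<^sup>2"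
      by (simp add: power_mult_distrib t(2) flip: mult.assoc)
    also have "(norm g)\<^sup>2 - 2 * t * (3 / 4 * (norm g)\<^sup>2) + t * (norm g)\<^sup>2 = (q * norm g)\<^sup>2"
      by (simp add: power_mult_distrib t(3) algebra_simps)
    finally have "norm (g - t *\<^sub>R y) \<le> q * norm g"
      by (rule power2_le_imp_le) (use q in simp)
    moreover have "t *\<^sub>R y = L (t *\<^sub>R blinfun_apply S g)"
      by (simp add: y_def L_def blinfun.scaleR_right scaleC_scaleR scaleR_diff_right)
    ultimately show ?thesis by auto
  qed
  have "bounded_linear L"
    unfolding L_def by (intro bounded_linear_sub blinfun.bounded_linear_right bounded_linear_scaleC_right)
  then have "subspace (range L)"
    by (simp add: bounded_linear.linear linear_subspace_image)
  then have dense: "closure (range L) = UNIV"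
    by (rule dense_if_approx_factor[OF _ q(1,2) near])
  have bW: "bounded (range W)" using W(1) by (auto simp: bounded_iff)
  have "?K \<in> bounded_operators"
    using A potential_op_bounded_operators[OF bW W(2)]
    by (simp add: bounded_operators_def blinfun.add_left scaleC_add_right)
  then show ?thesis
    by (rule resolvent_exists) (use below dense in \<open>simp_all add: L_def[abs_def]\<close>)
qed

section \<open>Translations\<close>

lemma norm_translation:
  fixes f :: "('x, 'k::complex_inner) ell2"
  assumes G: "group_action G UNIV \<phi>" and g: "\<gamma> \<in> carrier G"
  shows "norm (blinfun_apply (translation G \<phi> \<gamma>) f) = norm f"
proof -
  have "inv\<^bsub>G\<^esub> \<gamma> \<in> carrier G"
    using G g by (simp add: group_action_def group_hom_def)
  then have "bij (\<phi> (inv\<^bsub>G\<^esub> \<gamma>))"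
    using group_action.bij_prop0[OF G] by (auto simp: Bij_def)
  from infsum_reindex_bij_betw[OF this, of "\<lambda>x. (norm (ell2_apply f x))\<^sup>2"] show ?thesis
    by (simp add: norm_ell2.rep_eq ell2_norm_def translation_apply[OF G g])
qed

lemma translation_bounded_operators:
  assumes "group_action G UNIV \<phi>" "\<gamma> \<in> carrier G"
  shows "translation G \<phi> \<gamma> \<in> bounded_operators"
  unfolding bounded_operators_def
  by (auto intro!: ell2_eqI simp: translation_apply[OF assms])

lemma translation_inverse:
  fixes f :: "('x, 'k::complex_inner) ell2"
  assumes G: "group_action G UNIV \<phi>" and g: "\<gamma> \<in> carrier G"
  shows "blinfun_apply (translation G \<phi> \<gamma>) (blinfun_apply (translation G \<phi> (inv\<^bsub>G\<^esub> \<gamma>)) f) = f"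
proof (rule ell2_eqI)
  fix x
  have gi: "inv\<^bsub>G\<^esub> \<gamma> \<in> carrier G"
    using G g by (simp add: group_action_def group_hom_def)
  show "ell2_apply (blinfun_apply (translation G \<phi> \<gamma>)
      (blinfun_apply (translation G \<phi> (inv\<^bsub>G\<^esub> \<gamma>)) f)) x = ell2_apply f x"
    using group_action.orbit_sym_aux[OF G gi UNIV_I refl, of x]
    by (simp add: translation_apply[OF G g] translation_apply[OF G gi])
qed

text \<open>Translation acts on the first tensor factor only, so both sides agree on elementary tensors,
  and every vector is a convergent sum of these.\<close>

lemma ampliation_translation:
  fixes f :: "('x, 'k::complex_hilbert) ell2"
  assumes G: "group_action G UNIV \<phi>" and g: "\<gamma> \<in> carrier G"
    and A: "A \<in> bounded_operators"
    and comm: "A o\<^sub>L translation G \<phi> \<gamma> = translation G \<phi> \<gamma> o\<^sub>L A"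
  shows "blinfun_apply (ampliation A) (blinfun_apply (translation G \<phi> \<gamma>) f)
    = blinfun_apply (translation G \<phi> \<gamma>) (blinfun_apply (ampliation A) f)"
proof -
  let ?A = "ampliation A :: ('x, 'k) ell2 \<Rightarrow>\<^sub>L ('x, 'k) ell2"
  let ?U = "translation G \<phi> \<gamma> :: ('x, 'k) ell2 \<Rightarrow>\<^sub>L ('x, 'k) ell2"
  have tens: "blinfun_apply (translation G \<phi> \<gamma>) (elem_tensor u k)
      = elem_tensor (blinfun_apply (translation G \<phi> \<gamma>) u) k" for u and k :: 'k
    by (rule ell2_eqI) (simp add: translation_apply[OF G g])
  have c: "blinfun_apply A (blinfun_apply (translation G \<phi> \<gamma>) u)
      = blinfun_apply (translation G \<phi> \<gamma>) (blinfun_apply A u)" for u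
    using comm by (metis blinfun_apply_blinfun_compose)
  have eq: "blinfun_apply (?A o\<^sub>L ?U) (elem_tensor u k)
      = blinfun_apply (?U o\<^sub>L ?A) (elem_tensor u k)" for u k
    by (simp add: tens ampliation(2)[OF A] c)
  note has_sum_bounded_linear[OF blinfun.bounded_linear_right has_sum_unit[of f], unfolded comp_def]
  from this[of "?A o\<^sub>L ?U"] this[of "?U o\<^sub>L ?A"]
  have "blinfun_apply (?A o\<^sub>L ?U) f = blinfun_apply (?U o\<^sub>L ?A) f"
    unfolding eq by (rule has_sum_unique)
  then show ?thesis by simp
qed

lemma potential_op_translation:
  fixes f :: "('x, 'k::complex_inner) ell2"
  assumes G: "group_action G UNIV \<phi>" and g: "\<gamma> \<in> carrier G" and V: "bounded (range V)"
  shows "blinfun_apply (potential_op V) (blinfun_apply (translation G \<phi> \<gamma>) f)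
    = blinfun_apply (translation G \<phi> \<gamma>) (blinfun_apply (potential_op (\<lambda>x. V (\<phi> \<gamma> x))) f)"
proof (rule ell2_eqI)
  fix x
  have gi: "inv\<^bsub>G\<^esub> \<gamma> \<in> carrier G" and gii: "inv\<^bsub>G\<^esub> (inv\<^bsub>G\<^esub> \<gamma>) = \<gamma>"
    using G g by (simp_all add: group_action_def group_hom_def)
  have V': "bounded (range (\<lambda>x. V (\<phi> \<gamma> x)))"
    using V by (rule bounded_subset) auto
  have "\<phi> \<gamma> (\<phi> (inv\<^bsub>G\<^esub> \<gamma>) x) = x"
    using group_action.orbit_sym_aux[OF G gi UNIV_I refl, of x] by (simp add: gii)
  then show "ell2_apply (blinfun_apply (potential_op V) (blinfun_apply (translation G \<phi> \<gamma>) f)) x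
      = ell2_apply (blinfun_apply (translation G \<phi> \<gamma>)
          (blinfun_apply (potential_op (\<lambda>x. V (\<phi> \<gamma> x))) f)) x"
    by (simp add: translation_apply[OF G g] potential_op_apply[OF V] potential_op_apply[OF V'])
qed

text \<open>By the two intertwining relations above, $U_\gamma$ conjugates $A + V$ to
  $A + V(\gamma\,\cdot)$, and $U_\gamma$ is isometric.\<close>

lemma resolvent_translate:
  fixes V :: "'x \<Rightarrow> 'k::complex_hilbert \<Rightarrow>\<^sub>L 'k"
  assumes G: "group_action G UNIV \<phi>" and g: "\<gamma> \<in> carrier G"
    and A: "A \<in> bounded_operators"
    and comm: "A o\<^sub>L translation G \<phi> \<gamma> = translation G \<phi> \<gamma> o\<^sub>L A"
    and V: "bounded (range V)"
    and S: "is_resolvent z (ampliation A + potential_op V) S"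
  shows "\<exists>S'. is_resolvent z (ampliation A + potential_op (\<lambda>x. V (\<phi> \<gamma> x))) S' \<and> norm S' \<le> norm S"
proof -
  have gi: "inv\<^bsub>G\<^esub> \<gamma> \<in> carrier G" and gii: "inv\<^bsub>G\<^esub> (inv\<^bsub>G\<^esub> \<gamma>) = \<gamma>"
    using G g by (simp_all add: group_action_def group_hom_def)
  show ?thesis
  proof (rule resolvent_conjugate[where U="translation G \<phi> \<gamma>" and U'="translation G \<phi> (inv\<^bsub>G\<^esub> \<gamma>)", OF S])
    fix f :: "('x, 'k) ell2"
    show "blinfun_apply (translation G \<phi> (inv\<^bsub>G\<^esub> \<gamma>)) (blinfun_apply (translation G \<phi> \<gamma>) f) = f"
      using translation_inverse[OF G gi, of f] by (simp only: gii)
    show "blinfun_apply (ampliation A + potential_op V) (blinfun_apply (translation G \<phi> \<gamma>) f)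
        = blinfun_apply (translation G \<phi> \<gamma>)
            (blinfun_apply (ampliation A + potential_op (\<lambda>x. V (\<phi> \<gamma> x))) f)"
      by (simp add: blinfun.add_left blinfun.add_right ampliation_translation[OF G g A comm]
          potential_op_translation[OF G g V])
  qed (intro translation_bounded_operators translation_inverse norm_translation G g gi)+
qed

section \<open>Pseudo-ergodic potentials\<close>

text \<open>The translates of $V$ serve as the local approximations of $W$; being $M$-valued, they share the norm bound of $M$.\<close>

lemma Spec_pseudo_ergodic_maximal:
  fixes V W :: "'x \<Rightarrow> 'k::complex_hilbert \<Rightarrow>\<^sub>L 'k"
  assumes G: "group_action G UNIV \<phi>"
    and A: "A \<in> bounded_operators"
    and comm: "\<And>\<gamma>. \<gamma> \<in> carrier G \<Longrightarrow> A o\<^sub>L translation G \<phi> \<gamma> = translation G \<phi> \<gamma> o\<^sub>L A"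
    and M: "M \<subseteq> bounded_operators" "bounded M"
    and V: "pseudo_ergodic G \<phi> M V" and W: "\<And>x. W x \<in> M"
  shows "Spec (ampliation A + potential_op W) \<subseteq> Spec (ampliation A + potential_op V)"
proof -
  obtain C where C: "\<And>T. T \<in> M \<Longrightarrow> norm T \<le> C"
    using M(2) by (auto simp: bounded_iff)
  have VM: "V x \<in> M" for x using V by (simp add: pseudo_ergodic_def)
  then have bV: "bounded (range V)" by (intro bounded_subset[OF M(2)]) auto
  have "z \<notin> Spec (ampliation A + potential_op W)"
    if z: "z \<notin> Spec (ampliation A + potential_op V)" for z
  proof -
    obtain S where S: "is_resolvent z (ampliation A + potential_op V) S"
      using z unfolding notin_Spec_iff by blast
    show ?thesis
      unfolding notin_Spec_iff
    proof (rule resolvent_of_local_limit[where C=C and r="norm S"])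
      fix F :: "'x set" and \<epsilon> :: real assume "finite F" "0 < \<epsilon>"
      then obtain \<gamma> where g: "\<gamma> \<in> carrier G" "\<forall>x\<in>F. norm (W x - V (\<phi> \<gamma> x)) < \<epsilon>"
        using V W unfolding pseudo_ergodic_def by meson
      obtain S' where "is_resolvent z (ampliation A + potential_op (\<lambda>x. V (\<phi> \<gamma> x))) S'"
        "norm S' \<le> norm S"
        using resolvent_translate[OF G g(1) A comm[OF g(1)] bV S] by blast
      then show "\<exists>Q S'. (\<forall>x. norm (Q x) \<le> C) \<and> (\<forall>x\<in>F. norm (W x - Q x) \<le> \<epsilon>) \<and>
          is_resolvent z (ampliation A + potential_op Q) S' \<and> norm S' \<le> norm S"
        using g(2) C VM by (intro exI[of _ "\<lambda>x. V (\<phi> \<gamma> x)"] exI[of _ S']) (auto intro: less_imp_le)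
    qed (use ampliation(1)[OF A] W M(1) C in auto)
  qed
  then show ?thesis by blast
qed

theorem theorem1:
  fixes \<Gamma> :: "('g, 'm) monoid_scheme"
    and \<phi> :: "'g \<Rightarrow> 'x::countable \<Rightarrow> 'x"
    and H\<^sub>0 :: "('x, complex) ell2 \<Rightarrow>\<^sub>L ('x, complex) ell2"
    and M :: "('k::complex_hilbert \<Rightarrow>\<^sub>L 'k) set"
    and V W :: "'x \<Rightarrow> 'k \<Rightarrow>\<^sub>L 'k"
    and H K :: "('x, 'k) ell2 \<Rightarrow>\<^sub>L ('x, 'k) ell2"
  assumes "group_action \<Gamma> UNIV \<phi>"
    and "H\<^sub>0 \<in> bounded_operators"
    and "\<And>\<gamma>. \<gamma> \<in> carrier \<Gamma> \<Longrightarrow> H\<^sub>0 o\<^sub>L translation \<Gamma> \<phi> \<gamma> = translation \<Gamma> \<phi> \<gamma> o\<^sub>L H\<^sub>0"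
    and "M \<subseteq> bounded_operators" and "closed M" and "bounded M"
    and "pseudo_ergodic \<Gamma> \<phi> M V"
    and "\<And>x. W x \<in> M"
    and "H = ampliation H\<^sub>0 + potential_op V"
    and "K = ampliation H\<^sub>0 + potential_op W"
  shows "Spec K \<subseteq> Spec H \<and> (pseudo_ergodic \<Gamma> \<phi> M W \<longrightarrow> Spec H = Spec K)"
proof -
  note maximal = Spec_pseudo_ergodic_maximal[OF assms(1-4,6)]
  have "V x \<in> M" for x using assms(7) by (simp add: pseudo_ergodic_def)
  then have "Spec H \<subseteq> Spec K" if "pseudo_ergodic \<Gamma> \<phi> M W"
    unfolding assms(9,10) using that by (intro maximal)
  moreover have "Spec K \<subseteq> Spec H"
    unfolding assms(9,10) using assms(7,8) by (intro maximal)
  ultimately show ?thesis by blast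
qed

end
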